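(* Let $I\subseteq(0,\infty)$ be an interval with non-empty interior, let $p\in\mathbf{R}$, and let $f\colon I\to\mathbf{R}$ be the function $f(t)=t^p$. Then $f$ is $2$-monotone on $I$ if and only if $0\le p\le 1$, and $f$ is $2$-convex on $I$ if and only if either $1\le p\le 2$ or $-1\le p\le 0$.
   Context: Let $f$ be a real function defined in an interval $I\subseteq\mathbf{R}$ and let $n$ be a natural number. For a Hermitian $n\times n$ matrix $A$ with spectrum in $I$, $f(A)$ is defined by the functional calculus (apply $f$ to the eigenvalues in a spectral decomposition), and $A\le B$ means that $B-A$ is positive semi-definite. The function $f$ is called $n$-monotone if $A\le B$ implies $f(A)\le f(B)$ for arbitrary Hermitian $n\times n$ matrices $A,B$ with spectra in $I$. It is called $n$-convex if $f(\lambda A+(1-\lambda)B)\le\lambda f(A)+(1-\lambda)f(B)$ for all $\lambda\in[0,1]$ and arbitrary Hermitian $n\times n$ matrices $A,B$ with spectra in $I$. *)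

theory Defs
  imports "HOL-Analysis.Analysis" "Jordan_Normal_Form.Spectral_Radius"
    "Jordan_Normal_Form.Schur_Decomposition"
begin

definition hermitian_mat :: "complex mat \<Rightarrow> bool" where
  "hermitian_mat A \<longleftrightarrow> mat_adjoint A = A"

definition unitary_mat :: "nat \<Rightarrow> complex mat \<Rightarrow> bool" where
  "unitary_mat n U \<longleftrightarrow> U \<in> carrier_mat n n \<and>
     mat_adjoint U * U = 1\<^sub>m n \<and> U * mat_adjoint U = 1\<^sub>m n"

text \<open>The complex order is \<open>0 \<le> z \<longleftrightarrow> Im z = 0 \<and> 0 \<le> Re z\<close>.\<close>

definition psd_mat :: "nat \<Rightarrow> complex mat \<Rightarrow> bool" where
  "psd_mat n A \<longleftrightarrow> A \<in> carrier_mat n n \<and> hermitian_mat A \<and>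
     (\<forall>v \<in> carrier_vec n. 0 \<le> (A *\<^sub>v v) \<bullet>c v)"

definition loewner_le :: "nat \<Rightarrow> complex mat \<Rightarrow> complex mat \<Rightarrow> bool" where
  "loewner_le n A B \<longleftrightarrow> psd_mat n (B - A)"

definition real_diag :: "nat \<Rightarrow> (nat \<Rightarrow> real) \<Rightarrow> complex mat" where
  "real_diag n d = mat_diag n (\<lambda>i. complex_of_real (d i))"

definition spectral_decomposition :: "nat \<Rightarrow> complex mat \<Rightarrow> complex mat \<Rightarrow> (nat \<Rightarrow> real) \<Rightarrow> bool" where
  "spectral_decomposition n A U d \<longleftrightarrow>
     unitary_mat n U \<and> A = U * real_diag n d * mat_adjoint U"

text \<open>Meaningful only for Hermitian \<open>A\<close>, which are those with a spectral decomposition; the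
  result does not depend on the decomposition (lemma \<open>mat_fun_eq\<close> below) and involves the
  values of \<open>f\<close> only at the eigenvalues of \<open>A\<close>.\<close>

definition mat_fun :: "nat \<Rightarrow> (real \<Rightarrow> real) \<Rightarrow> complex mat \<Rightarrow> complex mat" where
  "mat_fun n f A = (THE B. \<exists>U d. spectral_decomposition n A U d \<and>
     B = U * real_diag n (\<lambda>i. f (d i)) * mat_adjoint U)"

definition hermitian_with_spectrum_in :: "nat \<Rightarrow> real set \<Rightarrow> complex mat set" where
  "hermitian_with_spectrum_in n I =
     {A \<in> carrier_mat n n. hermitian_mat A \<and> spectrum A \<subseteq> complex_of_real ` I}"

definition n_monotone_on :: "nat \<Rightarrow> real set \<Rightarrow> (real \<Rightarrow> real) \<Rightarrow> bool" where
  "n_monotone_on n I f \<longleftrightarrow>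
     (\<forall>A \<in> hermitian_with_spectrum_in n I. \<forall>B \<in> hermitian_with_spectrum_in n I.
        loewner_le n A B \<longrightarrow> loewner_le n (mat_fun n f A) (mat_fun n f B))"

definition n_convex_on :: "nat \<Rightarrow> real set \<Rightarrow> (real \<Rightarrow> real) \<Rightarrow> bool" where
  "n_convex_on n I f \<longleftrightarrow>
     (\<forall>A \<in> hermitian_with_spectrum_in n I. \<forall>B \<in> hermitian_with_spectrum_in n I.
      \<forall>l \<in> {0..1::real}.
        loewner_le n
          (mat_fun n f (complex_of_real l \<cdot>\<^sub>m A + complex_of_real (1 - l) \<cdot>\<^sub>m B))
          (complex_of_real l \<cdot>\<^sub>m mat_fun n f A + complex_of_real (1 - l) \<cdot>\<^sub>m mat_fun n f B))"

lemma mat_adjoint_carrier: "A \<in> carrier_mat n m \<Longrightarrow> mat_adjoint A \<in> carrier_mat m n"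
  unfolding mat_adjoint_def by (auto simp: mat_of_rows_def)

lemma real_diag_carrier: "real_diag n d \<in> carrier_mat n n"
  unfolding real_diag_def by simp

lemma conj_intertwine:
  assumes U: "unitary_mat n U" and V: "unitary_mat n V"
    and D: "D \<in> carrier_mat n n" and E: "E \<in> carrier_mat n n"
  shows "U * D * mat_adjoint U = V * E * mat_adjoint V \<longleftrightarrow>
         (mat_adjoint V * U) * D = E * (mat_adjoint V * U)" (is "?L \<longleftrightarrow> ?R")
proof -
  let ?U = "mat_adjoint U" and ?V = "mat_adjoint V"
  have c: "U \<in> carrier_mat n n" "?U \<in> carrier_mat n n" "V \<in> carrier_mat n n" "?V \<in> carrier_mat n n"
    using U V mat_adjoint_carrier unfolding unitary_mat_def by auto
  have u: "?U * U = 1\<^sub>m n" "U * ?U = 1\<^sub>m n" "?V * V = 1\<^sub>m n" "V * ?V = 1\<^sub>m n"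
    using U V unfolding unitary_mat_def by auto
  have assoc: "X * Y * Z = X * (Y * Z)"
    if "X \<in> carrier_mat n n" "Y \<in> carrier_mat n n" "Z \<in> carrier_mat n n" for X Y Z :: "complex mat"
    using that by (rule assoc_mult_mat)
  have cancel: "?U * (U * X) = X" "U * (?U * X) = X" "?V * (V * X) = X" "V * (?V * X) = X"
    if "X \<in> carrier_mat n n" for X
    using that c u by (metis assoc left_mult_one_mat)+
  show ?thesis
  proof
    assume ?L
    then have "?V * (U * D * ?U) * U = ?V * (V * E * ?V) * U" by simp
    then show ?R using c D E u by (simp add: assoc cancel)
  next
    assume ?R
    then have "V * (?V * U * D) * ?U = V * (E * (?V * U)) * ?U" by simp
    then show ?L using c D E u by (simp add: assoc cancel)
  qed
qed

lemma mat_fun_eq: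
  assumes "spectral_decomposition n A U d"
  shows "mat_fun n f A = U * real_diag n (\<lambda>i. f (d i)) * mat_adjoint U"
  unfolding mat_fun_def
proof (rule the_equality)
  show "\<exists>U' d'. spectral_decomposition n A U' d' \<and>
      U * real_diag n (\<lambda>i. f (d i)) * mat_adjoint U
      = U' * real_diag n (\<lambda>i. f (d' i)) * mat_adjoint U'"
    using assms by blast
next
  fix B assume "\<exists>V e. spectral_decomposition n A V e \<and>
     B = V * real_diag n (\<lambda>i. f (e i)) * mat_adjoint V"
  then obtain V e where V: "spectral_decomposition n A V e"
    and B: "B = V * real_diag n (\<lambda>i. f (e i)) * mat_adjoint V" by blast
  have uU: "unitary_mat n U" and uV: "unitary_mat n V"
    using assms V unfolding spectral_decomposition_def by auto
  define W where "W = mat_adjoint U * V"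
  have W: "W \<in> carrier_mat n n"
    using uU uV unfolding unitary_mat_def W_def by (meson mat_adjoint_carrier mult_carrier_mat)
  have "V * real_diag n e * mat_adjoint V = U * real_diag n d * mat_adjoint U"
    using assms V unfolding spectral_decomposition_def by simp
  then have "W * real_diag n e = real_diag n d * W"
    using conj_intertwine[OF uV uU real_diag_carrier real_diag_carrier] unfolding W_def by simp
  then have *: "Matrix.mat n n (\<lambda>(i,j). W $$ (i,j) * complex_of_real (e j))
      = Matrix.mat n n (\<lambda>(i,j). complex_of_real (d i) * W $$ (i,j))"
    unfolding real_diag_def mat_diag_mult_left[OF W] mat_diag_mult_right[OF W] .
  have "W $$ (i,j) * complex_of_real (f (e j)) = complex_of_real (f (d i)) * W $$ (i,j)"
    if "i < n" "j < n" for i j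
  proof -
    have "W $$ (i,j) * complex_of_real (e j) = complex_of_real (d i) * W $$ (i,j)"
      using arg_cong[OF *, of "\<lambda>M. M $$ (i,j)"] that by simp
    then have "W $$ (i,j) = 0 \<or> e j = d i" by (simp add: mult.commute)
    then show ?thesis by auto
  qed
  then have "W * real_diag n (\<lambda>i. f (e i)) = real_diag n (\<lambda>i. f (d i)) * W"
    unfolding real_diag_def mat_diag_mult_left[OF W] mat_diag_mult_right[OF W]
    by (intro eq_matI) auto
  then show "B = U * real_diag n (\<lambda>i. f (d i)) * mat_adjoint U"
    using conj_intertwine[OF uV uU real_diag_carrier real_diag_carrier] B
    unfolding W_def by simp
qed

end

theory Submission
  imports Defs
begin

text \<open>
For \<open>-1 < r < 0\<close> the substitution \<open>s \<mapsto> ts\<close> shows that \<open>t\<^sup>r\<close> is a positive multiple of the integral of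
\<open>s\<^sup>r / (t + s)\<close> over \<open>s > 0\<close>. Hence a finite combination of powers \<open>t\<^sub>k\<^sup>p\<close> inherits its sign from
the same combination of the functions \<open>t\<^sub>k\<^sup>m / (t\<^sub>k + s)\<close>, where \<open>p = r + m\<close>, and these reduce to
resolvents \<open>1 / (t\<^sub>k + s)\<close> when the combination annihilates polynomials of degree less than \<open>m\<close>. Since
\<open>\<langle>(A + s)\<^sup>-\<^sup>1 v, v\<rangle>\<close> is the supremum over \<open>x\<close> of \<open>2 Re \<langle>v, x\<rangle> - \<langle>(A + s) x, x\<rangle>\<close>, the resolvent is
antitone and convex in \<open>A\<close>, which gives sufficiency for \<open>p\<close> in the open intervals; the end points
follow by continuity in \<open>p\<close>. Conversely, with \<open>c\<^sub>k\<close> the binomial coefficients of \<open>p\<close>, a Taylor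
expansion at a scalar matrix yields \<open>c\<^sub>1 x\<^sup>2 + 2 c\<^sub>2 x + c\<^sub>3 \<ge> 0\<close> for all \<open>x\<close> in the monotone case and
\<open>c\<^sub>2 x\<^sup>2 + 2 c\<^sub>3 x + c\<^sub>4 \<ge> 0\<close> for all \<open>x\<close> in the convex case.
\<close>

section \<open>Powers as integrals of resolvents\<close>

text \<open>Near 0 the integrand is bounded by \<open>s powr r\<close>, integrable because
  \<open>-1 < r\<close>; near infinity it is bounded by \<open>s powr (r - 1)\<close>, integrable
  because \<open>r < 0\<close>.\<close>

lemma integrable_powr_resolvent:
  fixes r :: real
  assumes "-1 < r" "r < 0"
  shows "set_integrable lborel {0<..} (\<lambda>s. s powr r / (1 + s))"
proof -
  have "set_integrable lborel {0<..1} (\<lambda>s. s powr r / (1 + s))"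
  proof (rule set_integrable_bound)
    have "(\<lambda>s::real. s powr r) absolutely_integrable_on {0<..1}"
      by (intro nonnegative_absolutely_integrable_1 integrable_on_powr_from_0') (use assms in auto)
    \<comment> \<open>Absolute integrability refers to the completed measure; for a Borel function
      it passes to \<open>lborel\<close>.\<close>
    then show "set_integrable lborel {0<..1} (\<lambda>s::real. s powr r)"
      unfolding set_integrable_def by (subst (asm) integrable_completion) auto
  next
    show "set_borel_measurable lborel {0<..1} (\<lambda>s::real. s powr r / (1 + s))"
      unfolding set_borel_measurable_def by measurable
    show "AE s in lborel. s \<in> {0<..1} \<longrightarrow> norm (s powr r / (1 + s)) \<le> norm (s powr r)"
      by (auto simp: field_simps intro!: AE_I2)
  qed
  moreover have "set_integrable lborel {1..} (\<lambda>s. s powr r / (1 + s))"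
  proof (rule set_integrable_bound)
    have "(\<lambda>s::real. s powr (r-1)) absolutely_integrable_on {1..}"
      by (intro nonnegative_absolutely_integrable_1 has_integral_integrable[OF has_integral_powr_to_inf]) (use assms in auto)
    then show "set_integrable lborel {1..} (\<lambda>s::real. s powr (r-1))"
      unfolding set_integrable_def by (subst (asm) integrable_completion) auto
  next
    show "set_borel_measurable lborel {1..} (\<lambda>s::real. s powr r / (1 + s))"
      unfolding set_borel_measurable_def by measurable
    have "s powr r / (1 + s) \<le> s powr (r - 1)" if "s \<ge> 1" for s :: real
    proof -
      have "s powr (r - 1) = s powr r / s" using that by (simp add: powr_diff)
      also have "\<dots> \<ge> s powr r / (1 + s)" using that by (intro divide_left_mono) auto
      finally show ?thesis .
    qed
    then show "AE s in lborel. s \<in> {1..} \<longrightarrow> norm (s powr r / (1 + s)) \<le> norm (s powr (r - 1))"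
      by (auto intro!: AE_I2)
  qed
  ultimately have "set_integrable lborel ({0<..1} \<union> {1..}) (\<lambda>s. s powr r / (1 + s))"
    by (intro set_integrable_Un) auto
  moreover have "{0<..1} \<union> {1..} = {0::real<..}" by auto
  ultimately show ?thesis by simp
qed

lemma powr_resolvent_integral:
  fixes r t :: real
  assumes r: "-1 < r" "r < 0" and t: "0 < t"
  shows "set_integrable lborel {0<..} (\<lambda>s. s powr r / (t + s))" (is ?int)
    and "(LINT s:{0<..}|lborel. s powr r / (t + s))
         = t powr r * (LINT s:{0<..}|lborel. s powr r / (1 + s))" (is ?eq)
proof -
  let ?f = "\<lambda>t s. indicat_real {0<..} s *\<^sub>R (s powr r / (t + s))"
  \<comment> \<open>The summand 0 fits the affine change of variables in
    \<open>lborel_integral_real_affine\<close>; its Jacobian \<open>t\<close> raises the exponent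
    \<open>r - 1\<close> to \<open>r\<close>.\<close>
  have scale: "?f t (0 + t * s) = t powr (r - 1) * ?f 1 s" for s
  proof (cases "s > 0")
    case True
    have "(t * s) powr r / (t + t * s) = (t powr r / t) * (s powr r / (1 + s))"
      using t True by (simp add: powr_mult field_simps)
    then show ?thesis using t True by (simp add: powr_diff)
  next
    case False
    then show ?thesis using t by (simp add: mult_pos_pos zero_less_mult_iff)
  qed
  have "integrable lborel (\<lambda>s. ?f t (0 + t * s))"
    unfolding scale using integrable_powr_resolvent[OF r] unfolding set_integrable_def
    by (intro integrable_mult_right)
  then show ?int
    unfolding set_integrable_def using lborel_integrable_real_affine_iff[of t "?f t" 0] t by simp
  have "(\<integral>s. ?f t s \<partial>lborel) = \<bar>t\<bar> *\<^sub>R (\<integral>s. ?f t (0 + t * s) \<partial>lborel)"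
    using t by (intro lborel_integral_real_affine) simp
  also have "\<dots> = t * t powr (r - 1) * (\<integral>s. ?f 1 s \<partial>lborel)"
    unfolding scale integral_mult_right_zero using t by simp
  also have "t * t powr (r - 1) = t powr r" using t by (simp add: powr_diff)
  finally show ?eq unfolding set_lebesgue_integral_def .
qed

text \<open>The integrand is nonnegative and could vanish almost everywhere only if (0, 1) were a
  null set. Positivity lets this constant be divided out when signs are compared.\<close>

lemma powr_resolvent_integral_pos:
  fixes r :: real
  assumes r: "-1 < r" "r < 0"
  shows "0 < (LINT s:{0<..}|lborel. s powr r / (1 + s))"
proof -
  let ?I = "LINT s:{0<..}|lborel. s powr r / (1 + s)"
  have "?I = 0 \<longleftrightarrow> (AE s in lborel. indicat_real {0<..} s *\<^sub>R (s powr r / (1 + s)) = 0)"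
    unfolding set_lebesgue_integral_def
    using integrable_powr_resolvent[OF r] unfolding set_integrable_def
    by (intro integral_nonneg_eq_0_iff_AE) (auto simp: indicator_def)
  moreover have "\<not> (AE s in lborel. indicat_real {0<..} s *\<^sub>R (s powr r / (1 + s)) = 0)"
  proof
    assume "AE s in lborel. indicat_real {0<..} s *\<^sub>R (s powr r / (1 + s)) = 0"
    then have "AE s in lborel. s \<notin> {0<..<1::real}" by eventually_elim auto
    then have "emeasure lborel {s. 0 < s \<and> s < (1::real)} = 0"
      by (subst (asm) AE_iff_measurable[OF _ refl]) auto
    moreover have "{s. 0 < s \<and> s < 1} = {0<..<1::real}" by auto
    ultimately show False by simp
  qed
  moreover have "0 \<le> ?I" unfolding set_lebesgue_integral_def
    by (rule Bochner_Integration.integral_nonneg) (auto simp: indicator_def)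
  ultimately show ?thesis by linarith
qed

section \<open>Sign transfer from resolvents to powers\<close>

text \<open>Multiplied by the positive integral of \<open>s powr r / (1 + s)\<close>, the power sum
  becomes the integral of \<open>s powr r\<close> times the nonnegative resolvent sum.\<close>

lemma sum_powr_nonneg_interior:
  fixes c t :: "'k \<Rightarrow> real"
  assumes K: "finite K" and t: "\<And>k. k \<in> K \<Longrightarrow> 0 < t k"
    and res: "\<And>s. 0 < s \<Longrightarrow> 0 \<le> (\<Sum>k\<in>K. c k / (t k + s))"
    and r: "-1 < r" "r < 0"
  shows "0 \<le> (\<Sum>k\<in>K. c k * t k powr r)"
proof -
  let ?f = "\<lambda>t s. indicat_real {0<..} s *\<^sub>R (s powr r / (t + s))"
  let ?I = "LINT s:{0<..}|lborel. s powr r / (1 + s)"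
  have int: "integrable lborel (?f (t k))" if "k \<in> K" for k
    using powr_resolvent_integral(1)[OF r t[OF that]] unfolding set_integrable_def .
  have "(\<Sum>k\<in>K. c k * t k powr r) * ?I = (\<Sum>k\<in>K. c k * (\<integral>s. ?f (t k) s \<partial>lborel))"
    using powr_resolvent_integral(2)[OF r t]
    by (simp add: sum_distrib_right mult.assoc set_lebesgue_integral_def)
  also have "\<dots> = (\<integral>s. (\<Sum>k\<in>K. c k * ?f (t k) s) \<partial>lborel)"
    by (simp add: int Bochner_Integration.integral_sum del: times_divide_eq_right real_scaleR_def
        mult_scaleR_right scaleR_right_distrib)
  also have "\<dots> \<ge> 0"
  proof (rule Bochner_Integration.integral_nonneg)
    fix s :: real
    have "(\<Sum>k\<in>K. c k * ?f (t k) s) = indicat_real {0<..} s * s powr r * (\<Sum>k\<in>K. c k / (t k + s))"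
      by (simp add: sum_distrib_left field_simps)
    also have "\<dots> \<ge> 0" using res[of s] by (auto simp: indicator_def)
    finally show "0 \<le> (\<Sum>k\<in>K. c k * ?f (t k) s)" .
  qed
  finally show ?thesis
    using powr_resolvent_integral_pos[OF r] by (simp add: zero_le_mult_iff)
qed

text \<open>For positive bases the sum is continuous in the exponent. This supplies the integer end
  points, where the integral representation diverges.\<close>

lemma sum_powr_nonneg_closure:
  fixes c t :: "'k \<Rightarrow> real"
  assumes t: "\<And>k. k \<in> K \<Longrightarrow> 0 < t k"
    and *: "\<And>p. a < p \<Longrightarrow> p < b \<Longrightarrow> 0 \<le> (\<Sum>k\<in>K. c k * t k powr p)"
    and p: "a < b" "a \<le> p" "p \<le> b"
  shows "0 \<le> (\<Sum>k\<in>K. c k * t k powr p)"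
proof (rule continuous_ge_on_closure[of "{a<..<b}" "\<lambda>p. \<Sum>k\<in>K. c k * t k powr p"])
  show "continuous_on (closure {a<..<b}) (\<lambda>p. \<Sum>k\<in>K. c k * t k powr p)"
    using t by (intro continuous_intros) force+
  show "p \<in> closure {a<..<b}" using p by simp
qed (use * in auto)

text \<open>Writing t^q = t^m t^(q - m) puts the exponent \<open>q - m\<close> into (-1, 0). The
  factor t^m is absorbed into the coefficients, so \<open>m\<close> selects the unit interval of
  exponents.\<close>

lemma sum_powr_nonneg:
  fixes c t :: "'k \<Rightarrow> real" and m :: nat
  assumes K: "finite K" and t: "\<And>k. k \<in> K \<Longrightarrow> 0 < t k"
    and res: "\<And>s. 0 < s \<Longrightarrow> 0 \<le> (\<Sum>k\<in>K. c k * t k ^ m / (t k + s))"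
    and p: "real m - 1 \<le> p" "p \<le> real m"
  shows "0 \<le> (\<Sum>k\<in>K. c k * t k powr p)"
proof (rule sum_powr_nonneg_closure[OF t])
  fix q assume q: "real m - 1 < q" "q < real m"
  have "0 \<le> (\<Sum>k\<in>K. (c k * t k ^ m) * t k powr (q - m))"
    using K t res q by (intro sum_powr_nonneg_interior) auto
  also have "\<dots> = (\<Sum>k\<in>K. c k * t k powr q)"
    using t by (intro sum.cong) (auto simp: powr_diff powr_realpow)
  finally show "0 \<le> (\<Sum>k\<in>K. c k * t k powr q)" .
qed (use p in auto)

text \<open>Here \<open>m = 1\<close>. Since t / (t + s) = 1 - s / (t + s) and the coefficients sum
  to zero, only the resolvent sum survives, with the factor -s that reverses its sign.\<close>

lemma sum_powr_nonneg_monotone: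
  fixes c t :: "'k \<Rightarrow> real"
  assumes K: "finite K" and t: "\<And>k. k \<in> K \<Longrightarrow> 0 < t k"
    and c: "(\<Sum>k\<in>K. c k) = 0"
    and res: "\<And>s. 0 < s \<Longrightarrow> (\<Sum>k\<in>K. c k / (t k + s)) \<le> 0"
    and p: "0 \<le> p" "p \<le> 1"
  shows "0 \<le> (\<Sum>k\<in>K. c k * t k powr p)"
proof (rule sum_powr_nonneg[OF K t, where m = 1])
  fix s :: real assume s: "0 < s"
  have "c k * t k ^ 1 / (t k + s) = c k - s * (c k / (t k + s))" if "k \<in> K" for k
    using t[OF that] s by (simp add: field_simps)
  then have "(\<Sum>k\<in>K. c k * t k ^ 1 / (t k + s)) = (\<Sum>k\<in>K. c k - s * (c k / (t k + s)))" 
    by (intro sum.cong) auto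
  also have "\<dots> = - s * (\<Sum>k\<in>K. c k / (t k + s))"
    using c by (simp add: sum_subtractf sum_distrib_left[symmetric] del: times_divide_eq_right)
  finally show "0 \<le> (\<Sum>k\<in>K. c k * t k ^ 1 / (t k + s))"
    using res[OF s] s by (simp add: mult_nonneg_nonpos)
qed (use p in auto)

text \<open>The two ranges of \<open>p\<close> come from \<open>m = 2\<close> and
  \<open>m = 0\<close>. In the first, t^2 / (t + s) = t - s + s^2 / (t + s), and the two moment
  conditions remove the affine part.\<close>

lemma sum_powr_nonneg_convex:
  fixes c t :: "'k \<Rightarrow> real"
  assumes K: "finite K" and t: "\<And>k. k \<in> K \<Longrightarrow> 0 < t k"
    and c: "(\<Sum>k\<in>K. c k) = 0" "(\<Sum>k\<in>K. c k * t k) = 0"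
    and res: "\<And>s. 0 < s \<Longrightarrow> 0 \<le> (\<Sum>k\<in>K. c k / (t k + s))"
    and p: "1 \<le> p \<and> p \<le> 2 \<or> -1 \<le> p \<and> p \<le> 0"
  shows "0 \<le> (\<Sum>k\<in>K. c k * t k powr p)"
  using p
proof
  assume "-1 \<le> p \<and> p \<le> 0"
  then show ?thesis using res by (intro sum_powr_nonneg[OF K t, where m = 0]) auto
next
  assume p: "1 \<le> p \<and> p \<le> 2"
  show ?thesis
  proof (rule sum_powr_nonneg[OF K t, where m = 2])
    fix s :: real assume s: "0 < s"
    have "c k * (t k)\<^sup>2 / (t k + s) = c k * t k - s * c k + s\<^sup>2 * (c k / (t k + s))" if "k \<in> K" for k
      using t[OF that] s by (simp add: field_simps power2_eq_square)
    then have "(\<Sum>k\<in>K. c k * (t k)\<^sup>2 / (t k + s))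
        = (\<Sum>k\<in>K. c k * t k - s * c k + s\<^sup>2 * (c k / (t k + s)))"
      by (intro sum.cong) auto
    also have "\<dots> = s\<^sup>2 * (\<Sum>k\<in>K. c k / (t k + s))"
      using c by (simp add: sum.distrib sum_subtractf sum_distrib_left[symmetric] del: times_divide_eq_right)
    finally show "0 \<le> (\<Sum>k\<in>K. c k * (t k)\<^sup>2 / (t k + s))"
      using res[OF s] by simp
  qed (use p in auto)
qed

section \<open>Quadratic forms of matrix functions\<close>

lemma mat_adjoint_dim [simp]:
  "dim_row (mat_adjoint A) = dim_col A" "dim_col (mat_adjoint A) = dim_row A"
  by (simp_all add: mat_adjoint_def)

lemma mat_adjoint_index [simp]:
  fixes A :: "complex mat"
  assumes "i < dim_col A" "j < dim_row A"
  shows "mat_adjoint A $$ (i, j) = cnj (A $$ (j, i))"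
  using assms by (simp add: mat_adjoint_def mat_of_rows_def)

lemma mat_adjoint_mult:
  fixes A B :: "complex mat"
  assumes "A \<in> carrier_mat n m" "B \<in> carrier_mat m k"
  shows "mat_adjoint (A * B) = mat_adjoint B * mat_adjoint A"
  using assms by (intro eq_matI) (auto simp: scalar_prod_def mult.commute)

lemma mat_adjoint_adjoint [simp]:
  fixes A :: "complex mat"
  shows "mat_adjoint (mat_adjoint A) = A"
  by (intro eq_matI) auto

lemma cscalar_prod_adjoint:
  fixes A :: "complex mat"
  assumes "A \<in> carrier_mat n m" "x \<in> carrier_vec m" "y \<in> carrier_vec n"
  shows "(A *\<^sub>v x) \<bullet>c y = x \<bullet>c (mat_adjoint A *\<^sub>v y)"
proof -
  have "(A *\<^sub>v x) \<bullet>c y = (\<Sum>i<n. \<Sum>j<m. A $$ (i,j) * x $ j * cnj (y $ i))"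
    using assms by (auto simp: scalar_prod_def sum_distrib_right atLeast0LessThan intro!: sum.cong)
  also have "\<dots> = (\<Sum>j<m. \<Sum>i<n. A $$ (i,j) * x $ j * cnj (y $ i))"
    by (rule sum.swap)
  also have "\<dots> = x \<bullet>c (mat_adjoint A *\<^sub>v y)"
    using assms by (auto simp: scalar_prod_def sum_distrib_left atLeast0LessThan mult_ac intro!: sum.cong)
  finally show ?thesis .
qed

lemma hermitian_mat_combination:
  fixes A B :: "complex mat" and a b :: real
  assumes "A \<in> carrier_mat n n" "B \<in> carrier_mat n n" "hermitian_mat A" "hermitian_mat B"
  shows "hermitian_mat (complex_of_real a \<cdot>\<^sub>m A + complex_of_real b \<cdot>\<^sub>m B)"
proof -
  have "cnj (A $$ (j,i)) = A $$ (i,j)" "cnj (B $$ (j,i)) = B $$ (i,j)" if "i < n" "j < n" for i j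
    using assms that mat_adjoint_index[of i A j] mat_adjoint_index[of i B j]
    by (auto simp: hermitian_mat_def)
  then show ?thesis unfolding hermitian_mat_def
    using assms by (intro eq_matI) auto
qed

lemma hermitian_mat_diff:
  assumes "A \<in> carrier_mat n n" "B \<in> carrier_mat n n" "hermitian_mat A" "hermitian_mat B"
  shows "hermitian_mat (B - A)"
proof -
  have "B - A = complex_of_real 1 \<cdot>\<^sub>m B + complex_of_real (-1) \<cdot>\<^sub>m A"
    using assms(1,2) by (intro eq_matI) auto
  then show ?thesis using hermitian_mat_combination[OF assms(2,1,4,3)] by metis
qed

lemma quadratic_form_combination:
  fixes A B :: "complex mat" and a b :: complex
  assumes "A \<in> carrier_mat n n" "B \<in> carrier_mat n n" "v \<in> carrier_vec n"
  shows "((a \<cdot>\<^sub>m A + b \<cdot>\<^sub>m B) *\<^sub>v v) \<bullet>c v = a * ((A *\<^sub>v v) \<bullet>c v) + b * ((B *\<^sub>v v) \<bullet>c v)"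
proof -
  have smult: "(c \<cdot>\<^sub>m C) *\<^sub>v v = c \<cdot>\<^sub>v (C *\<^sub>v v)" if "C \<in> carrier_mat n n" for c and C :: "complex mat"
    using that assms(3) by (intro eq_vecI) auto
  show ?thesis
    using assms by (simp add: add_mult_distrib_mat_vec[of _ n n] smult add_scalar_prod_distrib[of _ n])
qed

lemma quadratic_form_diff:
  fixes A B :: "complex mat"
  assumes "A \<in> carrier_mat n n" "B \<in> carrier_mat n n" "v \<in> carrier_vec n"
  shows "((B - A) *\<^sub>v v) \<bullet>c v = ((B *\<^sub>v v) \<bullet>c v) - ((A *\<^sub>v v) \<bullet>c v)"
  using assms by (simp add: minus_mult_distrib_mat_vec[of _ n n] minus_scalar_prod_distrib[of _ n])

lemma hermitian_quadratic_form_real: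
  assumes "A \<in> carrier_mat n n" "hermitian_mat A" "v \<in> carrier_vec n"
  shows "Im ((A *\<^sub>v v) \<bullet>c v) = 0"
proof -
  have "(A *\<^sub>v v) \<bullet>c v = v \<bullet>c (A *\<^sub>v v)"
    using cscalar_prod_adjoint[OF assms(1,3,3)] assms(2) by (simp add: hermitian_mat_def)
  also have "\<dots> = cnj ((A *\<^sub>v v) \<bullet>c v)"
    using assms(1,3) by (auto simp: scalar_prod_def mult.commute)
  finally show ?thesis by (metis add.inverse_neutral cnj.simps(2) neg_equal_zero)
qed

text \<open>Quadratic forms of Hermitian matrices are real, so the complex order in
  \<open>psd_mat\<close> reduces to a comparison of real parts.\<close>

lemma loewner_le_iff:
  assumes "A \<in> carrier_mat n n" "B \<in> carrier_mat n n" "hermitian_mat A" "hermitian_mat B"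
  shows "loewner_le n A B \<longleftrightarrow>
    (\<forall>v \<in> carrier_vec n. Re ((A *\<^sub>v v) \<bullet>c v) \<le> Re ((B *\<^sub>v v) \<bullet>c v))"
  using assms hermitian_mat_diff[OF assms]
  by (auto simp: loewner_le_def psd_mat_def quadratic_form_diff less_eq_complex_def
      hermitian_quadratic_form_real)

section \<open>Matrix functions in an eigenbasis\<close>

lemma real_diag_mult_vec:
  assumes "w \<in> carrier_vec n"
  shows "real_diag n d *\<^sub>v w = vec n (\<lambda>i. complex_of_real (d i) * w $ i)"
proof (rule eq_vecI)
  fix i assume "i < dim_vec (vec n (\<lambda>i. complex_of_real (d i) * w $ i))"
  then have i: "i < n" by simp
  have "(real_diag n d *\<^sub>v w) $ i = (\<Sum>j<n. (if i = j then complex_of_real (d j) else 0) * w $ j)"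
    using i assms by (auto simp: real_diag_def mat_diag_def scalar_prod_def atLeast0LessThan intro!: sum.cong)
  also have "\<dots> = complex_of_real (d i) * w $ i"
    using i by (subst sum.remove[of _ i]) auto
  finally show "(real_diag n d *\<^sub>v w) $ i = vec n (\<lambda>i. complex_of_real (d i) * w $ i) $ i"
    using i by simp
qed (simp add: real_diag_def mat_diag_def)

lemma unitary_mat_cancel:
  assumes "unitary_mat n U" "w \<in> carrier_vec n"
  shows "mat_adjoint U *\<^sub>v (U *\<^sub>v w) = w" "U *\<^sub>v (mat_adjoint U *\<^sub>v w) = w"
  using assms by (auto simp: unitary_mat_def mat_adjoint_carrier simp flip: assoc_mult_mat_vec[of _ n n _ n])

lemma mult_mat_zero_vec:
  "A \<in> carrier_mat n m \<Longrightarrow> A *\<^sub>v 0\<^sub>v m = 0\<^sub>v n"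
  by (intro eq_vecI) (auto simp: scalar_prod_def)

lemma spectral_decompositionD:
  assumes "spectral_decomposition n A U d"
  shows "unitary_mat n U" "U \<in> carrier_mat n n" "mat_adjoint U \<in> carrier_mat n n"
    "A \<in> carrier_mat n n" "hermitian_mat A"
proof -
  show u: "unitary_mat n U" "U \<in> carrier_mat n n"
    using assms by (auto simp: spectral_decomposition_def unitary_mat_def)
  then show u': "mat_adjoint U \<in> carrier_mat n n"
    using mat_adjoint_carrier by blast
  have A: "A = U * real_diag n d * mat_adjoint U"
    using assms by (simp add: spectral_decomposition_def)
  have D: "mat_adjoint (real_diag n d) = real_diag n d"
    by (intro eq_matI) (auto simp: real_diag_def mat_diag_def)
  show "A \<in> carrier_mat n n" unfolding A by (rule mult_carrier_mat[OF mult_carrier_mat[OF u(2) real_diag_carrier] u'])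
  note D_carrier = real_diag_carrier[of n d]
  have "mat_adjoint A = mat_adjoint (mat_adjoint U) * mat_adjoint (U * real_diag n d)"
    unfolding A by (rule mat_adjoint_mult[OF mult_carrier_mat[OF u(2) D_carrier] u'])
  also have "mat_adjoint (U * real_diag n d) = real_diag n d * mat_adjoint U"
    unfolding mat_adjoint_mult[OF u(2) D_carrier] D ..
  also have "mat_adjoint (mat_adjoint U) * (real_diag n d * mat_adjoint U) = A"
    unfolding A mat_adjoint_adjoint by (rule assoc_mult_mat[OF u(2) D_carrier u', symmetric])
  finally show "hermitian_mat A" by (simp only: hermitian_mat_def)
qed

text \<open>The same \<open>U\<close> diagonalizes the matrix function, so facts about
  decompositions apply to \<open>mat_fun n f A\<close> as well.\<close>

lemma spectral_decomposition_mat_fun: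
  assumes "spectral_decomposition n A U d"
  shows "spectral_decomposition n (mat_fun n f A) U (\<lambda>i. f (d i))"
  using mat_fun_eq[OF assms] spectral_decompositionD(1)[OF assms]
  by (simp add: spectral_decomposition_def)

lemma spectral_decomposition_mult_vec:
  assumes "spectral_decomposition n A U d" "v \<in> carrier_vec n"
  shows "mat_adjoint U *\<^sub>v (A *\<^sub>v v) = real_diag n d *\<^sub>v (mat_adjoint U *\<^sub>v v)"
proof -
  note [simp] = spectral_decompositionD[OF assms(1)] real_diag_carrier
  have A: "A = U * real_diag n d * mat_adjoint U"
    using assms(1) by (simp add: spectral_decomposition_def)
  have "A *\<^sub>v v = U *\<^sub>v (real_diag n d *\<^sub>v (mat_adjoint U *\<^sub>v v))"
    unfolding A using assms(2)
    by (simp add: assoc_mult_mat_vec[of _ n n _ n] mult_carrier_mat[of _ n n] mult_mat_vec_carrier[of _ n n])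
  then show ?thesis
    using assms(2) by (simp add: unitary_mat_cancel[of n] mult_mat_vec_carrier[of _ n n])
qed

lemma unitary_cscalar_prod:
  assumes "unitary_mat n U" "v \<in> carrier_vec n" "x \<in> carrier_vec n"
  shows "v \<bullet>c x = (mat_adjoint U *\<^sub>v v) \<bullet>c (mat_adjoint U *\<^sub>v x)"
proof -
  have U: "U \<in> carrier_mat n n" "mat_adjoint U \<in> carrier_mat n n"
    using assms(1) mat_adjoint_carrier by (auto simp: unitary_mat_def)
  have "v \<bullet>c x = (U *\<^sub>v (mat_adjoint U *\<^sub>v v)) \<bullet>c x"
    using assms by (simp add: unitary_mat_cancel)
  also have "\<dots> = (mat_adjoint U *\<^sub>v v) \<bullet>c (mat_adjoint U *\<^sub>v x)"
    using assms U by (intro cscalar_prod_adjoint) auto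
  finally show ?thesis .
qed

lemma weighted_cscalar_prod:
  assumes "w \<in> carrier_vec n"
  shows "vec n (\<lambda>i. complex_of_real (d i) * w $ i) \<bullet>c w = complex_of_real (\<Sum>i<n. d i * (cmod (w $ i))\<^sup>2)"
proof -
  have "vec n (\<lambda>i. complex_of_real (d i) * w $ i) \<bullet>c w
      = (\<Sum>i<n. complex_of_real (d i) * w $ i * cnj (w $ i))"
    using assms by (simp add: scalar_prod_def atLeast0LessThan)
  also have "\<dots> = (\<Sum>i<n. complex_of_real (d i * (cmod (w $ i))\<^sup>2))"
    by (intro sum.cong refl) (simp only: of_real_mult complex_norm_square mult.assoc)
  finally show ?thesis by (simp only: of_real_sum)
qed

lemma spectral_quadratic_form:
  assumes "spectral_decomposition n A U d" "v \<in> carrier_vec n"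
  shows "(A *\<^sub>v v) \<bullet>c v = complex_of_real (\<Sum>i<n. d i * (cmod ((mat_adjoint U *\<^sub>v v) $ i))\<^sup>2)"
proof -
  note sd = spectral_decompositionD[OF assms(1)]
  have w: "mat_adjoint U *\<^sub>v v \<in> carrier_vec n"
    using sd(3) assms(2) by (rule mult_mat_vec_carrier)
  have "(A *\<^sub>v v) \<bullet>c v = (real_diag n d *\<^sub>v (mat_adjoint U *\<^sub>v v)) \<bullet>c (mat_adjoint U *\<^sub>v v)"
    unfolding spectral_decomposition_mult_vec[OF assms, symmetric]
    by (rule unitary_cscalar_prod[OF sd(1) mult_mat_vec_carrier[OF sd(4) assms(2)] assms(2)])
  also have "\<dots> = complex_of_real (\<Sum>i<n. d i * (cmod ((mat_adjoint U *\<^sub>v v) $ i))\<^sup>2)"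
    unfolding real_diag_mult_vec[OF w] weighted_cscalar_prod[OF w] ..
  finally show ?thesis .
qed

lemma spectral_Re_quadratic_form:
  assumes "spectral_decomposition n A U d" "v \<in> carrier_vec n"
  shows "Re ((A *\<^sub>v v) \<bullet>c v) = (\<Sum>i<n. d i * (cmod ((mat_adjoint U *\<^sub>v v) $ i))\<^sup>2)"
  unfolding spectral_quadratic_form[OF assms] by (rule Re_complex_of_real)

text \<open>This turns a matrix inequality into one about finite sums: the eigenvalues are the
  points, and the squared moduli of the coordinates of \<open>v\<close> in the eigenbasis are the
  weights.\<close>

lemma spectral_mat_fun_quadratic_form:
  assumes "spectral_decomposition n A U d" "v \<in> carrier_vec n"
  shows "Re ((mat_fun n f A *\<^sub>v v) \<bullet>c v) = (\<Sum>i<n. f (d i) * (cmod ((mat_adjoint U *\<^sub>v v) $ i))\<^sup>2)"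
  using spectral_Re_quadratic_form[OF spectral_decomposition_mat_fun[OF assms(1), of f] assms(2)] .

text \<open>Unitary maps preserve the norm, so the total weight depends on \<open>v\<close> alone;
  the difference of such sums for two matrices has coefficients summing to zero.\<close>

lemma spectral_norm_square:
  assumes "spectral_decomposition n A U d" "v \<in> carrier_vec n"
  shows "Re (v \<bullet>c v) = (\<Sum>i<n. (cmod ((mat_adjoint U *\<^sub>v v) $ i))\<^sup>2)"
proof -
  note sd = spectral_decompositionD[OF assms(1)]
  have w: "mat_adjoint U *\<^sub>v v \<in> carrier_vec n"
    using sd(3) assms(2) by (rule mult_mat_vec_carrier)
  have "v \<bullet>c v = vec n (\<lambda>i. complex_of_real 1 * (mat_adjoint U *\<^sub>v v) $ i) \<bullet>c (mat_adjoint U *\<^sub>v v)"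
    unfolding unitary_cscalar_prod[OF sd(1) assms(2) assms(2)]
    using carrier_vecD[OF w] sd(2) by (intro arg_cong2[where f = scalar_prod] eq_vecI) auto
  also have "\<dots> = complex_of_real (\<Sum>i<n. 1 * (cmod ((mat_adjoint U *\<^sub>v v) $ i))\<^sup>2)"
    unfolding weighted_cscalar_prod[OF w] ..
  finally have "v \<bullet>c v = complex_of_real (\<Sum>i<n. (cmod ((mat_adjoint U *\<^sub>v v) $ i))\<^sup>2)"
    by simp
  then show ?thesis by (simp only: Re_complex_of_real)
qed

text \<open>For an eigenvector \<open>v\<close> of \<open>A\<close>, the vector
  \<open>mat_adjoint U *\<^sub>v v\<close> is a nonzero eigenvector of the diagonal matrix, and any
  nonzero coordinate identifies the eigenvalue. Conversely, the columns of \<open>U\<close> are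
  eigenvectors of \<open>A\<close>.\<close>

lemma spectral_decomposition_spectrum:
  assumes "spectral_decomposition n A U d"
  shows "spectrum A = (\<lambda>i. complex_of_real (d i)) ` {..<n}"
proof -
  note [simp] = spectral_decompositionD[OF assms]
  note cancel = unitary_mat_cancel[OF spectral_decompositionD(1)[OF assms]]
  have "k \<in> (\<lambda>i. complex_of_real (d i)) ` {..<n}" if "k \<in> spectrum A" for k
  proof -
    from that obtain v where v: "v \<in> carrier_vec n" "v \<noteq> 0\<^sub>v n" "A *\<^sub>v v = k \<cdot>\<^sub>v v"
      using spectral_decompositionD(4)[OF assms] by (auto simp: spectrum_def eigenvalue_def eigenvector_def)
    define w where "w = mat_adjoint U *\<^sub>v v"
    have w: "w \<in> carrier_vec n" using v by (simp add: w_def mult_mat_vec_carrier[of _ n n])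
    have "real_diag n d *\<^sub>v w = k \<cdot>\<^sub>v w"
      using spectral_decomposition_mult_vec[OF assms v(1)] v
      by (simp add: w_def mult_mat_vec[of _ n n])
    then have *: "complex_of_real (d i) * w $ i = k * w $ i" if "i < n" for i
      using that w real_diag_mult_vec[OF w, of d]
      by (metis carrier_vecD index_smult_vec(1) index_vec)
    have "w \<noteq> 0\<^sub>v n"
    proof
      assume "w = 0\<^sub>v n"
      then have "U *\<^sub>v w = 0\<^sub>v n"
        using mult_mat_zero_vec[OF spectral_decompositionD(2)[OF assms]] by simp
      then show False using v cancel(2) by (simp add: w_def)
    qed
    then obtain i where "i < n" "w $ i \<noteq> 0" using w by (metis carrier_vecD eq_vecI index_zero_vec)
    then show ?thesis using * by auto
  qed
  moreover have "k \<in> spectrum A" if "k \<in> (\<lambda>i. complex_of_real (d i)) ` {..<n}" for k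
  proof -
    from that obtain i where i: "i < n" "k = complex_of_real (d i)" by auto
    let ?e = "unit_vec n i :: complex vec"
    have Ue: "U *\<^sub>v ?e \<in> carrier_vec n"
      by (rule mult_mat_vec_carrier[of _ n n]) auto
    have "mat_adjoint U *\<^sub>v (A *\<^sub>v (U *\<^sub>v ?e)) = real_diag n d *\<^sub>v ?e"
      using spectral_decomposition_mult_vec[OF assms Ue] by (simp add: cancel)
    also have "\<dots> = k \<cdot>\<^sub>v ?e"
      using i by (subst real_diag_mult_vec) (auto intro!: eq_vecI simp: unit_vec_def)
    finally have "U *\<^sub>v (mat_adjoint U *\<^sub>v (A *\<^sub>v (U *\<^sub>v ?e))) = k \<cdot>\<^sub>v (U *\<^sub>v ?e)"
      by (simp add: mult_mat_vec[of _ n n])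
    then have "A *\<^sub>v (U *\<^sub>v ?e) = k \<cdot>\<^sub>v (U *\<^sub>v ?e)"
      using cancel(2)[OF mult_mat_vec_carrier[OF spectral_decompositionD(4)[OF assms] Ue]] by simp
    moreover have "U *\<^sub>v ?e \<noteq> 0\<^sub>v n"
    proof
      assume "U *\<^sub>v ?e = 0\<^sub>v n"
      then have "mat_adjoint U *\<^sub>v (U *\<^sub>v ?e) = 0\<^sub>v n"
        using mult_mat_zero_vec[OF spectral_decompositionD(3)[OF assms]] by simp
      then have "?e = 0\<^sub>v n" by (simp add: cancel)
      then show False using i by (metis index_unit_vec(2) index_zero_vec(1) zero_neq_one)
    qed
    moreover have "dim_row A = n"
      by (rule carrier_matD(1)[OF spectral_decompositionD(4)[OF assms]])
    ultimately show ?thesis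
      unfolding spectrum_def eigenvalue_def eigenvector_def using Ue by blast
  qed
  ultimately show ?thesis by blast
qed

lemma spectral_decomposition_in:
  assumes "spectral_decomposition n A U d" "\<And>i. i < n \<Longrightarrow> d i \<in> I"
  shows "A \<in> hermitian_with_spectrum_in n I"
proof -
  have "spectrum A \<subseteq> complex_of_real ` I"
    unfolding spectral_decomposition_spectrum[OF assms(1)] using assms(2) by blast
  then show ?thesis
    using spectral_decompositionD(4,5)[OF assms(1)] by (simp add: hermitian_with_spectrum_in_def)
qed

section \<open>Variational form of the resolvent\<close>

text \<open>This is the scalar case of the variational formula: the concave quadratic in
  \<open>b\<close> has its maximum at \<open>b = a / D\<close>.\<close>

lemma square_completion:
  fixes a b D :: real
  assumes "0 < D"
  shows "2 * (a * b) - D * b\<^sup>2 \<le> a\<^sup>2 / D"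
proof -
  have "0 \<le> (a - D * b)\<^sup>2" by simp
  then have "(2 * (a * b) - D * b\<^sup>2) * D \<le> a\<^sup>2" by (simp add: power2_eq_square algebra_simps)
  then show ?thesis using assms by (simp add: pos_le_divide_eq)
qed

text \<open>The resolvent form is the supremum over \<open>x\<close> of an expression that is affine in \<open>A\<close>; this
  makes it antitone and convex in \<open>A\<close>.\<close>

lemma resolvent_form_ge:
  assumes A: "spectral_decomposition n A U d" and v: "v \<in> carrier_vec n" and x: "x \<in> carrier_vec n"
    and pos: "\<And>i. i < n \<Longrightarrow> 0 < d i + s"
  shows "2 * Re (v \<bullet>c x) - Re ((A *\<^sub>v x) \<bullet>c x) - s * Re (x \<bullet>c x)
    \<le> (\<Sum>i<n. (cmod ((mat_adjoint U *\<^sub>v v) $ i))\<^sup>2 / (d i + s))"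
proof -
  note [simp] = spectral_decompositionD[OF A]
  define w where "w = mat_adjoint U *\<^sub>v v"
  define y where "y = mat_adjoint U *\<^sub>v x"
  have wy: "w \<in> carrier_vec n" "y \<in> carrier_vec n"
    using v x by (simp_all add: w_def y_def mult_mat_vec_carrier[of _ n n])
  have *: "2 * Re (w $ i * cnj (y $ i)) - d i * (cmod (y $ i))\<^sup>2 - s * (cmod (y $ i))\<^sup>2
      \<le> (cmod (w $ i))\<^sup>2 / (d i + s)" if "i < n" for i
  proof -
    \<comment> \<open>Passing to moduli drops the phases and leaves an inequality between real
      numbers.\<close>
    have "Re (w $ i * cnj (y $ i)) \<le> cmod (w $ i) * cmod (y $ i)"
      using complex_Re_le_cmod[of "w $ i * cnj (y $ i)"] by (simp add: norm_mult)
    then show ?thesis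
      using square_completion[OF pos[OF that], of "cmod (w $ i)" "cmod (y $ i)"]
      by (simp add: algebra_simps)
  qed
  have "Re (v \<bullet>c x) = (\<Sum>i<n. Re (w $ i * cnj (y $ i)))"
    using wy v x by (subst unitary_cscalar_prod[of n U])
      (auto simp: scalar_prod_def atLeast0LessThan w_def[symmetric] y_def[symmetric] simp del: times_complex.sel)
  then have "2 * Re (v \<bullet>c x) - Re ((A *\<^sub>v x) \<bullet>c x) - s * Re (x \<bullet>c x)
      = (\<Sum>i<n. 2 * Re (w $ i * cnj (y $ i)) - d i * (cmod (y $ i))\<^sup>2 - s * (cmod (y $ i))\<^sup>2)"
    using spectral_Re_quadratic_form[OF A x] spectral_norm_square[OF A x]
    by (simp add: sum_subtractf sum_distrib_left y_def[symmetric] del: times_complex.sel)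
  also have "\<dots> \<le> (\<Sum>i<n. (cmod (w $ i))\<^sup>2 / (d i + s))"
    using * by (intro sum_mono) auto
  finally show ?thesis by (simp add: w_def)
qed

text \<open>The maximizer is (A + s)^-1 v; in the eigenbasis its coordinates are those of
  \<open>v\<close> divided by \<open>d i + s\<close>.\<close>

lemma resolvent_form_attained:
  assumes A: "spectral_decomposition n A U d" and v: "v \<in> carrier_vec n"
    and pos: "\<And>i. i < n \<Longrightarrow> 0 < d i + s"
  obtains x where "x \<in> carrier_vec n"
    "2 * Re (v \<bullet>c x) - Re ((A *\<^sub>v x) \<bullet>c x) - s * Re (x \<bullet>c x)
    = (\<Sum>i<n. (cmod ((mat_adjoint U *\<^sub>v v) $ i))\<^sup>2 / (d i + s))"
proof -
  note [simp] = spectral_decompositionD[OF A]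
  define w where "w = mat_adjoint U *\<^sub>v v"
  define y where "y = vec n (\<lambda>i. w $ i / complex_of_real (d i + s))"
  define x where "x = U *\<^sub>v y"
  have w: "w \<in> carrier_vec n"
    unfolding w_def by (rule mult_mat_vec_carrier[OF _ v]) simp
  have y: "y \<in> carrier_vec n" by (simp add: y_def)
  have x: "x \<in> carrier_vec n"
    unfolding x_def by (rule mult_mat_vec_carrier[OF _ y]) simp
  have yx: "mat_adjoint U *\<^sub>v x = y" unfolding x_def by (rule unitary_mat_cancel(1)[OF _ y]) simp
  have *: "2 * (a\<^sup>2 / D) - D * (a / D)\<^sup>2 = a\<^sup>2 / D" if "0 < D" for a D :: real
    using that by (simp add: field_simps power2_eq_square)
  have **: "2 * Re (w $ i * cnj (y $ i)) - d i * (cmod (y $ i))\<^sup>2 - s * (cmod (y $ i))\<^sup>2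
      = (cmod (w $ i))\<^sup>2 / (d i + s)" if "i < n" for i
  proof -
    have "w $ i * cnj (y $ i) = complex_of_real ((cmod (w $ i))\<^sup>2 / (d i + s))"
      using that by (simp add: y_def complex_norm_square del: of_real_power of_real_add)
    then have "Re (w $ i * cnj (y $ i)) = (cmod (w $ i))\<^sup>2 / (d i + s)"
      by (metis Re_complex_of_real)
    moreover have "cmod (y $ i) = cmod (w $ i) / (d i + s)"
      using that pos[OF that] by (simp add: y_def norm_divide del: of_real_add)
    ultimately show ?thesis
      using *[OF pos[OF that], of "cmod (w $ i)"] by (simp add: distrib_right del: times_complex.sel)
  qed
  have "Re (v \<bullet>c x) = (\<Sum>i<n. Re (w $ i * cnj (y $ i)))"
    using y v x by (subst unitary_cscalar_prod[of n U])
      (auto simp: scalar_prod_def atLeast0LessThan w_def[symmetric] yx simp del: times_complex.sel)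
  then have "2 * Re (v \<bullet>c x) - Re ((A *\<^sub>v x) \<bullet>c x) - s * Re (x \<bullet>c x)
      = (\<Sum>i<n. 2 * Re (w $ i * cnj (y $ i)) - d i * (cmod (y $ i))\<^sup>2 - s * (cmod (y $ i))\<^sup>2)"
    using spectral_Re_quadratic_form[OF A x] spectral_norm_square[OF A x]
    by (simp add: sum_subtractf sum_distrib_left yx del: times_complex.sel)
  also have "\<dots> = (\<Sum>i<n. (cmod (w $ i))\<^sup>2 / (d i + s))"
    using ** by (intro sum.cong) auto
  finally show ?thesis using that x by (simp add: w_def)
qed

section \<open>Power inequalities in arbitrary dimension\<close>

text \<open>The eigenvalues of both matrices are pooled over a disjoint sum of index sets, those of
  \<open>A\<close> with negative and those of \<open>B\<close> with positive weights, so that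
  \<open>sum_powr_nonneg_monotone\<close> applies.\<close>

lemma loewner_le_powr_form:
  assumes A: "spectral_decomposition n A U d" and B: "spectral_decomposition n B V e"
    and pos: "\<And>i. i < n \<Longrightarrow> 0 < d i" "\<And>i. i < n \<Longrightarrow> 0 < e i"
    and le: "loewner_le n A B" and v: "v \<in> carrier_vec n" and p: "0 \<le> p" "p \<le> 1"
  shows "(\<Sum>i<n. d i powr p * (cmod ((mat_adjoint U *\<^sub>v v) $ i))\<^sup>2)
    \<le> (\<Sum>i<n. e i powr p * (cmod ((mat_adjoint V *\<^sub>v v) $ i))\<^sup>2)"
proof -
  define a where "a i = (cmod ((mat_adjoint U *\<^sub>v v) $ i))\<^sup>2" for i
  define b where "b i = (cmod ((mat_adjoint V *\<^sub>v v) $ i))\<^sup>2" for i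
  let ?K = "{..<n} <+> {..<n}"
  let ?c = "case_sum (\<lambda>i. - a i) b" and ?t = "case_sum d e"
  have "0 \<le> (\<Sum>k\<in>?K. ?c k * ?t k powr p)"
  proof (rule sum_powr_nonneg_monotone)
    show "(\<Sum>k\<in>?K. ?c k) = 0"
      using spectral_norm_square[OF A v] spectral_norm_square[OF B v]
      by (simp add: sum.Plus sum_negf a_def b_def)
  next
    fix s :: real assume s: "0 < s"
    \<comment> \<open>The maximizer for \<open>B\<close> is only a competitor for \<open>A\<close>,
      and passing from \<open>B\<close> to \<open>A\<close> does not increase the subtracted form;
      hence the resolvent form of \<open>B\<close> is at most that of \<open>A\<close>.\<close>
    obtain x where x: "x \<in> carrier_vec n"
      "2 * Re (v \<bullet>c x) - Re ((B *\<^sub>v x) \<bullet>c x) - s * Re (x \<bullet>c x) = (\<Sum>i<n. b i / (e i + s))"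
      using resolvent_form_attained[OF B v add_pos_pos[OF pos(2) s]] unfolding b_def .
    have "2 * Re (v \<bullet>c x) - Re ((A *\<^sub>v x) \<bullet>c x) - s * Re (x \<bullet>c x) \<le> (\<Sum>i<n. a i / (d i + s))"
      unfolding a_def by (rule resolvent_form_ge[OF A v x(1) add_pos_pos[OF pos(1) s]])
    moreover have "Re ((A *\<^sub>v x) \<bullet>c x) \<le> Re ((B *\<^sub>v x) \<bullet>c x)"
      using le x(1) loewner_le_iff[OF spectral_decompositionD(4)[OF A] spectral_decompositionD(4)[OF B]
          spectral_decompositionD(5)[OF A] spectral_decompositionD(5)[OF B]] by blast
    ultimately have "(\<Sum>i<n. b i / (e i + s)) \<le> (\<Sum>i<n. a i / (d i + s))"
      using x(2) by linarith
    then show "(\<Sum>k\<in>?K. ?c k / (?t k + s)) \<le> 0"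
      by (simp add: sum.Plus sum_negf)
  qed (use pos p in auto)
  then show ?thesis
    by (simp add: sum.Plus sum_negf a_def b_def mult.commute)
qed

text \<open>Three families of eigenvalues are pooled: those of the combination with negative
  weights, those of \<open>A\<close> and \<open>B\<close> with weights scaled by \<open>l\<close>
  and \<open>1 - l\<close>.\<close>

lemma convex_combination_powr_form:
  fixes l :: real
  assumes A: "spectral_decomposition n A U d" and B: "spectral_decomposition n B V e"
    and C: "spectral_decomposition n (complex_of_real l \<cdot>\<^sub>m A + complex_of_real (1 - l) \<cdot>\<^sub>m B) W g"
    and pos: "\<And>i. i < n \<Longrightarrow> 0 < d i" "\<And>i. i < n \<Longrightarrow> 0 < e i" "\<And>i. i < n \<Longrightarrow> 0 < g i"
    and l: "0 \<le> l" "l \<le> 1" and v: "v \<in> carrier_vec n"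
    and p: "1 \<le> p \<and> p \<le> 2 \<or> -1 \<le> p \<and> p \<le> 0"
  shows "(\<Sum>i<n. g i powr p * (cmod ((mat_adjoint W *\<^sub>v v) $ i))\<^sup>2)
    \<le> l * (\<Sum>i<n. d i powr p * (cmod ((mat_adjoint U *\<^sub>v v) $ i))\<^sup>2)
      + (1 - l) * (\<Sum>i<n. e i powr p * (cmod ((mat_adjoint V *\<^sub>v v) $ i))\<^sup>2)"
proof -
  define a where "a i = (cmod ((mat_adjoint U *\<^sub>v v) $ i))\<^sup>2" for i
  define b where "b i = (cmod ((mat_adjoint V *\<^sub>v v) $ i))\<^sup>2" for i
  define c where "c i = (cmod ((mat_adjoint W *\<^sub>v v) $ i))\<^sup>2" for i
  let ?C = "complex_of_real l \<cdot>\<^sub>m A + complex_of_real (1 - l) \<cdot>\<^sub>m B"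
  have form: "Re ((?C *\<^sub>v x) \<bullet>c x) = l * Re ((A *\<^sub>v x) \<bullet>c x) + (1 - l) * Re ((B *\<^sub>v x) \<bullet>c x)"
    if "x \<in> carrier_vec n" for x
    unfolding quadratic_form_combination[OF spectral_decompositionD(4)[OF A] spectral_decompositionD(4)[OF B] that]
    by simp
  let ?K = "{..<n} <+> ({..<n} <+> {..<n})"
  let ?c = "case_sum (\<lambda>i. - c i) (case_sum (\<lambda>i. l * a i) (\<lambda>i. (1 - l) * b i))"
  let ?t = "case_sum g (case_sum d e)"
  have "0 \<le> (\<Sum>k\<in>?K. ?c k * ?t k powr p)"
  proof (rule sum_powr_nonneg_convex)
    have "(\<Sum>i<n. c i) = (\<Sum>i<n. a i)" "(\<Sum>i<n. b i) = (\<Sum>i<n. a i)"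
      using spectral_norm_square[OF A v] spectral_norm_square[OF B v] spectral_norm_square[OF C v]
      by (simp_all add: a_def b_def c_def)
    then show "(\<Sum>k\<in>?K. ?c k) = 0"
      by (simp add: sum.Plus sum_negf flip: sum_distrib_left) (simp add: algebra_simps)
    \<comment> \<open>Linearity of the quadratic form in the matrix makes the first moments
      cancel.\<close>
    have "(\<Sum>i<n. g i * c i) = l * (\<Sum>i<n. d i * a i) + (1 - l) * (\<Sum>i<n. e i * b i)"
      using form[OF v] spectral_Re_quadratic_form[OF A v] spectral_Re_quadratic_form[OF B v]
        spectral_Re_quadratic_form[OF C v] by (simp add: a_def b_def c_def)
    then show "(\<Sum>k\<in>?K. ?c k * ?t k) = 0"
      by (simp add: sum.Plus sum_negf sum_distrib_left mult_ac)
  next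
    fix s :: real assume s: "0 < s"
    \<comment> \<open>The maximizer for the combination is tested against \<open>A\<close> and
      \<open>B\<close> at once. The maximized expression is affine in the matrix, so the weighted
      average of the two test values is exactly the maximum for the combination.\<close>
    obtain x where x: "x \<in> carrier_vec n"
      "2 * Re (v \<bullet>c x) - Re ((?C *\<^sub>v x) \<bullet>c x) - s * Re (x \<bullet>c x) = (\<Sum>i<n. c i / (g i + s))"
      using resolvent_form_attained[OF C v add_pos_pos[OF pos(3) s]] unfolding c_def .
    let ?m = "\<lambda>M. 2 * Re (v \<bullet>c x) - Re ((M *\<^sub>v x) \<bullet>c x) - s * Re (x \<bullet>c x)"
    have "?m A \<le> (\<Sum>i<n. a i / (d i + s))"
      unfolding a_def by (rule resolvent_form_ge[OF A v x(1) add_pos_pos[OF pos(1) s]])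
    moreover have "?m B \<le> (\<Sum>i<n. b i / (e i + s))"
      unfolding b_def by (rule resolvent_form_ge[OF B v x(1) add_pos_pos[OF pos(2) s]])
    ultimately have "l * ?m A + (1 - l) * ?m B
        \<le> l * (\<Sum>i<n. a i / (d i + s)) + (1 - l) * (\<Sum>i<n. b i / (e i + s))"
      using l by (intro add_mono mult_left_mono) auto
    moreover have "l * ?m A + (1 - l) * ?m B = (\<Sum>i<n. c i / (g i + s))"
      unfolding x(2)[symmetric] form[OF x(1)] by (simp add: algebra_simps)
    ultimately show "0 \<le> (\<Sum>k\<in>?K. ?c k / (?t k + s))"
      by (simp add: sum.Plus sum_negf sum_distrib_left)
  qed (use pos p in auto)
  then show ?thesis
    by (simp add: sum.Plus sum_negf a_def b_def c_def sum_distrib_left mult_ac)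
qed

section \<open>Two-by-two matrices\<close>

definition mat2 :: "complex \<Rightarrow> complex \<Rightarrow> complex \<Rightarrow> complex \<Rightarrow> complex mat" where
  "mat2 a b c d = Matrix.mat 2 2
     (\<lambda>(i, j). if i = 0 then if j = 0 then a else b else if j = 0 then c else d)"

text \<open>The index 1 is written \<open>Suc 0\<close>, its normal form under the
  simplifier.\<close>

lemma mat2_carrier [simp]: "mat2 a b c d \<in> carrier_mat 2 2"
  and mat2_dim [simp]: "dim_row (mat2 a b c d) = 2" "dim_col (mat2 a b c d) = 2"
  and mat2_index [simp]:
    "mat2 a b c d $$ (0, 0) = a" "mat2 a b c d $$ (0, Suc 0) = b"
    "mat2 a b c d $$ (Suc 0, 0) = c" "mat2 a b c d $$ (Suc 0, Suc 0) = d"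
  by (simp_all add: mat2_def)

lemma eq_mat2:
  assumes "A \<in> carrier_mat 2 2"
  shows "A = mat2 (A $$ (0, 0)) (A $$ (0, 1)) (A $$ (1, 0)) (A $$ (1, 1))"
  using assms by (intro eq_matI) (auto simp: less_2_cases_iff)

lemma mat2_eq_iff:
  "mat2 a b c d = mat2 a' b' c' d' \<longleftrightarrow> a = a' \<and> b = b' \<and> c = c' \<and> d = d'"
  by (metis mat2_index)

lemma mat2_arith:
  "mat2 a b c d * mat2 a' b' c' d' = mat2 (a*a' + b*c') (a*b' + b*d') (c*a' + d*c') (c*b' + d*d')"
  "mat2 a b c d + mat2 a' b' c' d' = mat2 (a + a') (b + b') (c + c') (d + d')"
  "k \<cdot>\<^sub>m mat2 a b c d = mat2 (k * a) (k * b) (k * c) (k * d)"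
  "mat_adjoint (mat2 a b c d) = mat2 (cnj a) (cnj c) (cnj b) (cnj d)"
  "1\<^sub>m 2 = mat2 1 0 0 1"
  "real_diag 2 e = mat2 (e 0) 0 0 (e 1)"
proof -
  have "(\<Sum>i = 0..<2. h i) = h 0 + h 1" for h :: "nat \<Rightarrow> complex"
    by (simp add: numeral_2_eq_2)
  then show
    "mat2 a b c d * mat2 a' b' c' d' = mat2 (a*a' + b*c') (a*b' + b*d') (c*a' + d*c') (c*b' + d*d')"
    by (intro eq_matI) (auto simp: less_2_cases_iff scalar_prod_def)
qed (auto intro!: eq_matI simp: less_2_cases_iff real_diag_def mat_diag_def)

lemma mat2_quadratic_form:
  "(mat2 a b c d *\<^sub>v vec 2 v) \<bullet>c vec 2 v
    = (a * v 0 + b * v 1) * cnj (v 0) + (c * v 0 + d * v 1) * cnj (v 1)"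
  by (simp add: scalar_prod_def numeral_2_eq_2)

section \<open>Diagonalization and spectra of Hermitian two-by-two matrices\<close>

text \<open>A unit eigenvector (x, y) exists over the complex numbers, and (-cnj y, cnj x) completes
  it to a unitary matrix.\<close>

lemma hermitian_spectral_decomposition_2:
  assumes A: "A \<in> carrier_mat 2 2" and herm: "hermitian_mat A"
  obtains U d where "spectral_decomposition 2 A U d"
proof -
  define p q q' r where "p = A $$ (0, 0)" "q = A $$ (0, 1)" "q' = A $$ (1, 0)" "r = A $$ (1, 1)"
  note A_eq = eq_mat2[OF A, folded p_q_q'_r_def]
  have "mat2 (cnj p) (cnj q') (cnj q) (cnj r) = mat2 p q q' r"
    using herm A_eq mat2_arith(4) by (metis hermitian_mat_def)
  then have conj: "cnj p = p" "cnj q = q'" "cnj q' = q" "cnj r = r"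
    by (simp_all add: mat2_eq_iff)
  obtain k v where v: "v \<in> carrier_vec 2" "v \<noteq> 0\<^sub>v 2" "A *\<^sub>v v = k \<cdot>\<^sub>v v"
    using spectrum_non_empty[OF A] A by (auto simp: spectrum_def eigenvalue_def eigenvector_def)
  have v_eq: "v = vec 2 (\<lambda>i. v $ i)" using v(1) by auto
  define N where "N = sqrt ((cmod (v $ 0))\<^sup>2 + (cmod (v $ 1))\<^sup>2)"
  have "v $ 0 \<noteq> 0 \<or> v $ 1 \<noteq> 0"
    using v(1,2) by (auto simp: less_2_cases_iff intro!: eq_vecI)
  then have N: "N > 0" "N\<^sup>2 = (cmod (v $ 0))\<^sup>2 + (cmod (v $ 1))\<^sup>2"
    by (auto simp: N_def add_pos_nonneg add_nonneg_pos)
  define x y where "x = v $ 0 / N" "y = v $ 1 / N"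
  have unit: "x * cnj x + y * cnj y = 1"
  proof -
    have "x * cnj x + y * cnj y = (v $ 0 * cnj (v $ 0) + v $ 1 * cnj (v $ 1)) / (N * N)"
      by (simp add: x_y_def add_divide_distrib)
    also have "\<dots> = complex_of_real (N\<^sup>2) / (N * N)"
      unfolding N(2) by (simp only: complex_norm_square of_real_add)
    also have "\<dots> = 1" using N(1) by (simp add: power2_eq_square)
    finally show ?thesis .
  qed
  have eig: "p * x + q * y = k * x" "q' * x + r * y = k * y"
  proof -
    have "(A *\<^sub>v v) $ i = k * v $ i" if "i < 2" for i
      unfolding v(3) using v(1) that by simp
    from this[of 0] this[of 1] have "p * v $ 0 + q * v $ 1 = k * v $ 0" "q' * v $ 0 + r * v $ 1 = k * v $ 1"
      using v(1) A by (simp_all add: p_q_q'_r_def scalar_prod_def numeral_2_eq_2)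
    then show "p * x + q * y = k * x" "q' * x + r * y = k * y"
      by (simp_all add: x_y_def flip: add_divide_distrib)
  qed
  have eig': "p * cnj x + q' * cnj y = cnj k * cnj x" "q * cnj x + r * cnj y = cnj k * cnj y"
    using arg_cong[OF eig(1), of cnj] arg_cong[OF eig(2), of cnj] by (simp_all add: conj)
  \<comment> \<open>The quadratic form at the unit eigenvector is computed in two ways, from the
    eigenvector equations and from their conjugates.\<close>
  have k: "cnj k = k"
  proof -
    have "k = (k * x) * cnj x + (k * y) * cnj y"
      using arg_cong[OF unit, of "(*) k"] by (simp add: algebra_simps)
    also have "\<dots> = (cnj k * cnj x) * x + (cnj k * cnj y) * y"
      unfolding eig[symmetric] eig'[symmetric] by (simp add: algebra_simps)
    also have "\<dots> = cnj k"
      using arg_cong[OF unit, of "(*) (cnj k)"] by (simp add: algebra_simps)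
    finally show ?thesis ..
  qed
  \<comment> \<open>The second eigenvalue is the trace minus the first.\<close>
  define m where "m = p + r - k"
  have m: "cnj m = m" by (simp add: m_def conj k)
  have real: "complex_of_real (Re k) = k" "complex_of_real (Re m) = m"
    using k m by (simp_all add: Reals_cnj_iff)
  define U where "U = mat2 x (- cnj y) y (cnj x)"
  have "unitary_mat 2 U"
    using unit by (simp add: unitary_mat_def U_def mat2_arith mult.commute add.commute)
  moreover have "A = U * real_diag 2 (\<lambda>i. if i = 0 then Re k else Re m) * mat_adjoint U"
  proof -
    let ?u = "x * cnj x + y * cnj y"
    let ?e1 = "p * x + q * y - k * x" and ?e2 = "q' * x + r * y - k * y"
    let ?f1 = "p * cnj x + q' * cnj y - k * cnj x" and ?f2 = "q * cnj x + r * cnj y - k * cnj y"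
    have zero: "?e1 = 0" "?e2 = 0" "?f1 = 0" "?f2 = 0"
      using eig eig'[unfolded k] by simp_all
    \<comment> \<open>Each entry's defect is a combination of the eigenvector equations and of
      \<open>1 - ?u\<close>, all of which vanish; the identities themselves are polynomial.\<close>
    have "p - (k * x * cnj x + m * y * cnj y) = p * (1 - ?u) + cnj x * ?e1 - y * ?f2"
      "r - (k * y * cnj y + m * x * cnj x) = r * (1 - ?u) + cnj y * ?e2 - x * ?f1"
      "q - (k * x * cnj y - m * x * cnj y) = q * (1 - ?u) + cnj y * ?e1 + x * ?f2"
      "q' - (k * y * cnj x - m * y * cnj x) = q' * (1 - ?u) + cnj x * ?e2 + y * ?f1"
      unfolding m_def by (simp_all add: algebra_simps)
    then have "p = k * x * cnj x + m * y * cnj y" "r = k * y * cnj y + m * x * cnj x"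
      "q = k * x * cnj y - m * x * cnj y" "q' = k * y * cnj x - m * y * cnj x"
      unfolding zero unit by simp_all
    then show ?thesis
      by (subst A_eq) (simp add: U_def mat2_arith real mult_ac)
  qed
  ultimately show thesis using that by (simp add: spectral_decomposition_def)
qed

lemma hermitian_with_spectrum_in_2_decomposition:
  assumes "A \<in> hermitian_with_spectrum_in 2 I"
  obtains U d where "spectral_decomposition 2 A U d" "\<And>i. i < 2 \<Longrightarrow> d i \<in> I"
proof -
  have A: "A \<in> carrier_mat 2 2" "hermitian_mat A" "spectrum A \<subseteq> complex_of_real ` I"
    using assms by (auto simp: hermitian_with_spectrum_in_def)
  obtain U d where sd: "spectral_decomposition 2 A U d"
    using hermitian_spectral_decomposition_2[OF A(1,2)] .
  have "d i \<in> I" if "i < 2" for i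
    using A(3) that unfolding spectral_decomposition_spectrum[OF sd] by (auto simp: image_subset_iff)
  then show thesis using that sd by blast
qed

text \<open>The squared moduli of the coordinates of a unit vector are convex weights, so the form
  is a convex combination of eigenvalues.\<close>

lemma quadratic_form_in_convex:
  assumes sd: "spectral_decomposition n A U d" and d: "\<And>i. i < n \<Longrightarrow> d i \<in> I" and "convex I"
    and x: "x \<in> carrier_vec n" and unit: "Re (x \<bullet>c x) = 1"
  shows "Re ((A *\<^sub>v x) \<bullet>c x) \<in> I"
proof -
  have "(\<Sum>i<n. (cmod ((mat_adjoint U *\<^sub>v x) $ i))\<^sup>2 *\<^sub>R d i) \<in> I"
    using d \<open>convex I\<close> unit spectral_norm_square[OF sd x] by (intro convex_sum) auto
  then show ?thesis
    unfolding spectral_Re_quadratic_form[OF sd x] by (simp add: mult.commute)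
qed

lemma eigenvalue_quadratic_form:
  assumes sd: "spectral_decomposition n A U d" and i: "i < n"
  obtains x where "x \<in> carrier_vec n" "Re (x \<bullet>c x) = 1" "Re ((A *\<^sub>v x) \<bullet>c x) = d i"
proof -
  note U = spectral_decompositionD[OF sd]
  define x where "x = U *\<^sub>v unit_vec n i"
  have x: "x \<in> carrier_vec n" unfolding x_def by (rule mult_mat_vec_carrier[OF U(2)]) simp
  have Ux: "mat_adjoint U *\<^sub>v x = unit_vec n i"
    unfolding x_def by (rule unitary_mat_cancel(1)[OF U(1)]) simp
  have "(\<Sum>j<n. h j * (cmod (unit_vec n i $ j))\<^sup>2) = h i" for h :: "nat \<Rightarrow> real"
    using i by (subst sum.remove[of _ i]) auto
  from this[of "\<lambda>_. 1"] this[of d] show thesis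
    using that[OF x] spectral_norm_square[OF sd x] spectral_Re_quadratic_form[OF sd x]
    unfolding Ux by simp
qed

text \<open>An eigenvalue of the combination is a value of its form at a unit vector, hence a convex
  combination of values for \<open>A\<close> and \<open>B\<close>, which lie in \<open>I\<close>.
  This places the spectrum where \<open>f\<close> is later prescribed.\<close>

lemma convex_combination_spectrum_in_2:
  fixes l :: real
  assumes A: "A \<in> hermitian_with_spectrum_in 2 I" and B: "B \<in> hermitian_with_spectrum_in 2 I"
    and I: "convex I" and l: "0 \<le> l" "l \<le> 1"
  shows "complex_of_real l \<cdot>\<^sub>m A + complex_of_real (1 - l) \<cdot>\<^sub>m B \<in> hermitian_with_spectrum_in 2 I"
    (is "?C \<in> _")
proof -
  obtain U d where sA: "spectral_decomposition 2 A U d" "\<And>i. i < 2 \<Longrightarrow> d i \<in> I"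
    using hermitian_with_spectrum_in_2_decomposition[OF A] by blast
  obtain V e where sB: "spectral_decomposition 2 B V e" "\<And>i. i < 2 \<Longrightarrow> e i \<in> I"
    using hermitian_with_spectrum_in_2_decomposition[OF B] by blast
  note cA = spectral_decompositionD(4,5)[OF sA(1)] and cB = spectral_decompositionD(4,5)[OF sB(1)]
  have "?C \<in> carrier_mat 2 2" using cA cB by simp
  then obtain W g where sC: "spectral_decomposition 2 ?C W g"
    using hermitian_spectral_decomposition_2 hermitian_mat_combination[OF cA(1) cB(1) cA(2) cB(2)]
    by blast
  have "g i \<in> I" if i: "i < 2" for i
  proof -
    obtain x where x: "x \<in> carrier_vec 2" "Re (x \<bullet>c x) = 1" "Re ((?C *\<^sub>v x) \<bullet>c x) = g i"
      using eigenvalue_quadratic_form[OF sC i] .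
    have "g i = l *\<^sub>R Re ((A *\<^sub>v x) \<bullet>c x) + (1 - l) *\<^sub>R Re ((B *\<^sub>v x) \<bullet>c x)"
      unfolding x(3)[symmetric] quadratic_form_combination[OF cA(1) cB(1) x(1)] by simp
    also have "\<dots> \<in> I"
      using I l quadratic_form_in_convex[OF sA I x(1,2)] quadratic_form_in_convex[OF sB I x(1,2)]
      by (intro convexD) auto
    finally show ?thesis .
  qed
  then show ?thesis by (rule spectral_decomposition_in[OF sC])
qed

section \<open>Sufficiency in dimension 2\<close>

lemma powr_form_eq:
  assumes "spectral_decomposition n A U d" "\<And>i. i < n \<Longrightarrow> d i \<in> I" "v \<in> carrier_vec n"
    and "\<And>t. t \<in> I \<Longrightarrow> f t = t powr p"
  shows "Re ((mat_fun n f A *\<^sub>v v) \<bullet>c v) = (\<Sum>i<n. d i powr p * (cmod ((mat_adjoint U *\<^sub>v v) $ i))\<^sup>2)"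
  unfolding spectral_mat_fun_quadratic_form[OF assms(1,3)]
  using assms(2,4) by (intro sum.cong) auto

text \<open>The dimension enters through the existence of spectral decompositions; the scalar
  inequality \<open>loewner_le_powr_form\<close> holds for every \<open>n\<close>.\<close>

lemma n_monotone_on_2_powr:
  assumes I: "I \<subseteq> {0<..}" and f: "\<And>t. t \<in> I \<Longrightarrow> f t = t powr p" and p: "0 \<le> p" "p \<le> 1"
  shows "n_monotone_on 2 I f"
  unfolding n_monotone_on_def
proof (intro ballI impI)
  fix A B
  assume A: "A \<in> hermitian_with_spectrum_in 2 I" and B: "B \<in> hermitian_with_spectrum_in 2 I"
    and le: "loewner_le 2 A B"
  obtain U d where sA: "spectral_decomposition 2 A U d" "\<And>i. i < 2 \<Longrightarrow> d i \<in> I"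
    using hermitian_with_spectrum_in_2_decomposition[OF A] by blast
  obtain V e where sB: "spectral_decomposition 2 B V e" "\<And>i. i < 2 \<Longrightarrow> e i \<in> I"
    using hermitian_with_spectrum_in_2_decomposition[OF B] by blast
  have pos: "\<And>i. i < 2 \<Longrightarrow> 0 < d i" "\<And>i. i < 2 \<Longrightarrow> 0 < e i"
    using sA(2) sB(2) I by auto
  note fA = spectral_decompositionD(4,5)[OF spectral_decomposition_mat_fun[OF sA(1), of f]]
    and fB = spectral_decompositionD(4,5)[OF spectral_decomposition_mat_fun[OF sB(1), of f]]
  have form: "Re ((mat_fun 2 f M *\<^sub>v v) \<bullet>c v)
      = (\<Sum>i<2. h i powr p * (cmod ((mat_adjoint X *\<^sub>v v) $ i))\<^sup>2)"
    if "spectral_decomposition 2 M X h" "\<And>i. i < 2 \<Longrightarrow> h i \<in> I" "v \<in> carrier_vec 2" for M X h v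
    using that f by (rule powr_form_eq)
  show "loewner_le 2 (mat_fun 2 f A) (mat_fun 2 f B)"
    unfolding loewner_le_iff[OF fA(1) fB(1) fA(2) fB(2)]
  proof
    fix v :: "complex vec" assume v: "v \<in> carrier_vec 2"
    show "Re ((mat_fun 2 f A *\<^sub>v v) \<bullet>c v) \<le> Re ((mat_fun 2 f B *\<^sub>v v) \<bullet>c v)"
      using form[OF sA(1) sA(2) v] form[OF sB(1) sB(2) v]
      by simp (rule loewner_le_powr_form[OF sA(1) sB(1) pos le v p])
  qed
qed

lemma n_convex_on_2_powr:
  assumes I: "I \<subseteq> {0<..}" "convex I" and f: "\<And>t. t \<in> I \<Longrightarrow> f t = t powr p"
    and p: "1 \<le> p \<and> p \<le> 2 \<or> -1 \<le> p \<and> p \<le> 0"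
  shows "n_convex_on 2 I f"
  unfolding n_convex_on_def
proof (intro ballI)
  fix A B and l :: real
  assume A: "A \<in> hermitian_with_spectrum_in 2 I" and B: "B \<in> hermitian_with_spectrum_in 2 I"
    and "l \<in> {0..1}"
  then have l: "0 \<le> l" "l \<le> 1" by auto
  let ?C = "complex_of_real l \<cdot>\<^sub>m A + complex_of_real (1 - l) \<cdot>\<^sub>m B"
  obtain U d where sA: "spectral_decomposition 2 A U d" "\<And>i. i < 2 \<Longrightarrow> d i \<in> I"
    using hermitian_with_spectrum_in_2_decomposition[OF A] by blast
  obtain V e where sB: "spectral_decomposition 2 B V e" "\<And>i. i < 2 \<Longrightarrow> e i \<in> I"
    using hermitian_with_spectrum_in_2_decomposition[OF B] by blast
  obtain W g where sC: "spectral_decomposition 2 ?C W g" "\<And>i. i < 2 \<Longrightarrow> g i \<in> I"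
    using hermitian_with_spectrum_in_2_decomposition[OF convex_combination_spectrum_in_2[OF A B I(2) l]] by blast
  have pos: "\<And>i. i < 2 \<Longrightarrow> 0 < d i" "\<And>i. i < 2 \<Longrightarrow> 0 < e i" "\<And>i. i < 2 \<Longrightarrow> 0 < g i"
    using sA(2) sB(2) sC(2) I(1) by auto
  note fA = spectral_decompositionD(4,5)[OF spectral_decomposition_mat_fun[OF sA(1), of f]]
    and fB = spectral_decompositionD(4,5)[OF spectral_decomposition_mat_fun[OF sB(1), of f]]
    and fC = spectral_decompositionD(4,5)[OF spectral_decomposition_mat_fun[OF sC(1), of f]]
  have form: "Re ((mat_fun 2 f M *\<^sub>v v) \<bullet>c v)
      = (\<Sum>i<2. h i powr p * (cmod ((mat_adjoint X *\<^sub>v v) $ i))\<^sup>2)"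
    if "spectral_decomposition 2 M X h" "\<And>i. i < 2 \<Longrightarrow> h i \<in> I" "v \<in> carrier_vec 2" for M X h v
    using that f by (rule powr_form_eq)
  let ?F = "complex_of_real l \<cdot>\<^sub>m mat_fun 2 f A + complex_of_real (1 - l) \<cdot>\<^sub>m mat_fun 2 f B"
  have F: "?F \<in> carrier_mat 2 2" "hermitian_mat ?F"
    using fA fB by simp (rule hermitian_mat_combination[OF fA(1) fB(1) fA(2) fB(2)])
  show "loewner_le 2 (mat_fun 2 f ?C) ?F"
    unfolding loewner_le_iff[OF fC(1) F(1) fC(2) F(2)]
  proof
    fix v :: "complex vec" assume v: "v \<in> carrier_vec 2"
    have "Re ((?F *\<^sub>v v) \<bullet>c v)
        = l * Re ((mat_fun 2 f A *\<^sub>v v) \<bullet>c v) + (1 - l) * Re ((mat_fun 2 f B *\<^sub>v v) \<bullet>c v)"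
      unfolding quadratic_form_combination[OF fA(1) fB(1) v] by simp
    then show "Re ((mat_fun 2 f ?C *\<^sub>v v) \<bullet>c v) \<le> Re ((?F *\<^sub>v v) \<bullet>c v)"
      using form[OF sA(1) sA(2) v] form[OF sB(1) sB(2) v] form[OF sC(1) sC(2) v]
        convex_combination_powr_form[OF sA(1) sB(1) sC(1) pos l v p] by presburger
  qed
qed

section \<open>Necessity\<close>

text \<open>By the binomial series the quotient is, for small nonzero \<open>y\<close>, a power
  series with constant term \<open>p gchoose n\<close>.\<close>

lemma powr_taylor_remainder_limit:
  fixes p :: real
  shows "((\<lambda>y. ((1 + y) powr p - (\<Sum>k<n. (p gchoose k) * y ^ k)) / y ^ n) \<longlongrightarrow> p gchoose n) (at 0)"
proof -
  have "((\<lambda>y. ((1 + y) powr p - (\<Sum>k<n. (p gchoose k) * y ^ k)) / y ^ n) \<longlongrightarrow> p gchoose (0 + n)) (at 0)"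
  proof (rule powser_limit_0_strong[where s = 1 and a = "\<lambda>k. p gchoose (k + n)"])
    fix y :: real assume y: "y \<noteq> 0" "norm y < 1"
    have "(\<lambda>k. (p gchoose (k + n)) * y ^ (k + n)) sums ((1 + y) powr p - (\<Sum>k<n. (p gchoose k) * y ^ k))"
      using gen_binomial_real[of y p] y by (intro sums_split_initial_segment) auto
    from sums_divide[OF this, of "y ^ n"]
    show "(\<lambda>k. (p gchoose (k + n)) * y ^ k) sums (((1 + y) powr p - (\<Sum>k<n. (p gchoose k) * y ^ k)) / y ^ n)"
      using y by (simp add: power_add)
  qed simp
  then show ?thesis by simp
qed

text \<open>The scaled limits serve arguments such as \<open>2 * h\<close> and
  \<open>- h / 2\<close>, which come from the eigenvalues of the test matrices.\<close>

lemma powr_taylor_remainder: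
  fixes p :: real
  obtains \<rho> where "\<And>y. (1 + y) powr p = (\<Sum>k<n. (p gchoose k) * y ^ k) + \<rho> y * y ^ n"
    "\<And>c. c \<noteq> 0 \<Longrightarrow> ((\<lambda>h. \<rho> (c * h)) \<longlongrightarrow> p gchoose n) (at_right 0)"
proof -
  \<comment> \<open>The value at 0 keeps the expansion valid there: for \<open>n = 0\<close> the
    power \<open>0 ^ 0\<close> is 1 and forces the value 1, otherwise the factor
    \<open>y ^ n\<close> vanishes.\<close>
  define \<rho> where "\<rho> y = (if y = 0 then (if n = 0 then 1 else 0) else
      ((1 + y) powr p - (\<Sum>k<n. (p gchoose k) * y ^ k)) / y ^ n)" for y
  have "(1 + y) powr p = (\<Sum>k<n. (p gchoose k) * y ^ k) + \<rho> y * y ^ n" for y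
  proof (cases "y = 0")
    case True
    then show ?thesis by (cases n) (auto simp: \<rho>_def sum.lessThan_Suc_shift)
  qed (simp add: \<rho>_def)
  moreover have lim: "(\<rho> \<longlongrightarrow> p gchoose n) (at 0)"
    using powr_taylor_remainder_limit
    by (rule Lim_transform_eventually) (auto simp: \<rho>_def eventually_at_filter)
  have "((\<lambda>h. \<rho> (c * h)) \<longlongrightarrow> p gchoose n) (at_right 0)" if "c \<noteq> 0" for c
  proof (rule filterlim_compose[OF lim])
    have "((\<lambda>h. c * h) \<longlongrightarrow> c * 0) (at_right 0)" by (intro tendsto_intros)
    moreover have "\<forall>\<^sub>F h in at_right 0. c * h \<noteq> 0"
      using that by (auto simp: eventually_at_filter)
    ultimately show "filterlim (\<lambda>h. c * h) (at 0) (at_right 0)"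
      by (auto simp: filterlim_at)
  qed
  ultimately show thesis using that by blast
qed

lemma quadratic_nonneg_imp:
  fixes A B C :: real
  assumes "\<And>x. 0 \<le> A * x\<^sup>2 + 2 * B * x + C"
  shows "0 \<le> A" "B\<^sup>2 \<le> A * C"
proof -
  show A: "0 \<le> A"
  proof (rule ccontr)
    assume "\<not> 0 \<le> A"
    \<comment> \<open>Adding the values at \<open>x\<close> and \<open>- x\<close> cancels the
      linear term, and this \<open>x\<close> makes the rest negative.\<close>
    define x where "x = sqrt ((\<bar>C\<bar> + 1) / - A)"
    have "A * x\<^sup>2 = - (\<bar>C\<bar> + 1)"
      using \<open>\<not> 0 \<le> A\<close> by (simp add: x_def divide_nonneg_neg)
    then show False using assms[of x] assms[of "- x"] by simp
  qed
  show "B\<^sup>2 \<le> A * C"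
  proof (cases "A = 0")
    case True
    \<comment> \<open>At the chosen point the function \<open>2 * B * x + C\<close> would equal
      -1.\<close>
    have "B = 0"
      using assms[of "- (C + 1) / (2 * B)"] True by (cases "B = 0") auto
    then show ?thesis using True by simp
  next
    case False
    \<comment> \<open>The polynomial is evaluated at its minimizer \<open>- B / A\<close>.\<close>
    have "0 \<le> A * (A * (- B / A)\<^sup>2 + 2 * B * (- B / A) + C)"
      using A assms by (intro mult_nonneg_nonneg)
    also have "\<dots> = A * C - B\<^sup>2" using False by (simp add: field_simps power2_eq_square)
    finally show ?thesis by simp
  qed
qed

lemma gbinomial_2_3_4:
  fixes p :: real
  shows "p gchoose 2 = p * (p - 1) / 2" "p gchoose 3 = p * (p - 1) * (p - 2) / 6"
    "p gchoose 4 = p * (p - 1) * (p - 2) * (p - 3) / 24"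
  by (simp_all add: gbinomial_prod_rev numeral_eq_Suc fact_reduce)

text \<open>The hypothesis compares quadratic forms at the test vector (u, 1). For u = x h, ten
  times the difference is h^3 F(h), and F(h) tends to 15 times the claimed polynomial.\<close>

lemma powr_expansion_monotone:
  fixes p x :: real
  defines "g \<equiv> \<lambda>s. (1 + s) powr p"
  assumes "\<forall>\<^sub>F h in at_right 0. \<forall>u.
    (g h * (u + 1)\<^sup>2 + g (- h) * (1 - u)\<^sup>2) / 2 \<le> (g (2 * h) * (2 * u + 1)\<^sup>2 + g (- h / 2) * (2 - u)\<^sup>2) / 5"
  shows "0 \<le> p * x\<^sup>2 + 2 * (p gchoose 2) * x + (p gchoose 3)"
proof -
  obtain \<rho> where \<rho>: "\<And>y. (1 + y) powr p = (\<Sum>k<3. (p gchoose k) * y ^ k) + \<rho> y * y ^ 3"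
    and lim: "\<And>c. c \<noteq> 0 \<Longrightarrow> ((\<lambda>h. \<rho> (c * h)) \<longlongrightarrow> p gchoose 3) (at_right 0)"
    using powr_taylor_remainder by blast
  \<comment> \<open>The remainders are taken at a constant times \<open>h\<close>, even for
    \<open>1 * h\<close>, so that \<open>lim\<close> matches.\<close>
  define F where "F h = 15 * (p * x\<^sup>2 + 2 * (p gchoose 2) * x) + 45/2 * (p gchoose 2) * x\<^sup>2 * h
      + 2 * (8 * \<rho> (2 * h) * (2 * (x * h) + 1)\<^sup>2 - \<rho> (- (1/2) * h) / 8 * (2 - x * h)\<^sup>2)
      - 5 * (\<rho> (1 * h) * (x * h + 1)\<^sup>2 - \<rho> (- 1 * h) * (1 - x * h)\<^sup>2)" for h
  have "0 \<le> F h" if h: "0 < h" and le: "\<forall>u. (g h * (u + 1)\<^sup>2 + g (- h) * (1 - u)\<^sup>2) / 2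
      \<le> (g (2 * h) * (2 * u + 1)\<^sup>2 + g (- h / 2) * (2 - u)\<^sup>2) / 5" for h
  proof -
    have g: "g y = 1 + p * y + (p gchoose 2) * y\<^sup>2 + \<rho> y * y ^ 3" for y
      unfolding g_def \<rho> by (simp add: numeral_3_eq_3 numeral_2_eq_2)
    define u where "u = x * h"
    have "0 \<le> 2 * (g (2 * h) * (2 * u + 1)\<^sup>2 + g (- h / 2) * (2 - u)\<^sup>2)
        - 5 * (g h * (u + 1)\<^sup>2 + g (- h) * (1 - u)\<^sup>2)"
      using le[rule_format, of u] by linarith
    also have "\<dots> = h ^ 3 * F h"
      unfolding g F_def u_def by (simp add: field_simps power2_eq_square power3_eq_cube)
    finally show ?thesis using h by (simp add: zero_le_mult_iff)
  qed
  moreover have "\<forall>\<^sub>F h in at_right (0::real). 0 < h" by (simp add: eventually_at_filter)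
  ultimately have "\<forall>\<^sub>F h in at_right 0. 0 \<le> F h"
    using assms(2) by (auto elim: eventually_elim2)
  moreover have "(F \<longlongrightarrow> 15 * (p * x\<^sup>2 + 2 * (p gchoose 2) * x) + 45/2 * (p gchoose 2) * x\<^sup>2 * 0
      + 2 * (8 * (p gchoose 3) * (2 * (x * 0) + 1)\<^sup>2 - (p gchoose 3) / 8 * (2 - x * 0)\<^sup>2)
      - 5 * ((p gchoose 3) * (x * 0 + 1)\<^sup>2 - (p gchoose 3) * (1 - x * 0)\<^sup>2)) (at_right 0)"
    unfolding F_def by (intro tendsto_intros lim) auto
  ultimately show ?thesis
    using tendsto_lowerbound[of F _ "at_right 0" 0] by (fastforce simp: field_simps)
qed

text \<open>As in the monotone case, but the midpoint inequality has leading order four: ten times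
  the difference is h^4 F(h), and F(h) tends to 45/2 times the claimed polynomial.\<close>

lemma powr_expansion_convex:
  fixes p x :: real
  defines "g \<equiv> \<lambda>s. (1 + s) powr p"
  assumes "\<forall>\<^sub>F h in at_right 0. \<forall>u.
    (g h * (u + 1)\<^sup>2 + g (- h) * (1 - u)\<^sup>2) / 2
      \<le> ((g (2 * h) * (2 * u + 1)\<^sup>2 + g (- h / 2) * (2 - u)\<^sup>2) / 5
        + (g (- 2 * h) * (2 * u - 1)\<^sup>2 + g (h / 2) * (2 + u)\<^sup>2) / 5) / 2"
  shows "0 \<le> (p gchoose 2) * x\<^sup>2 + 2 * (p gchoose 3) * x + (p gchoose 4)"
proof -
  obtain \<rho> where \<rho>: "\<And>y. (1 + y) powr p = (\<Sum>k<4. (p gchoose k) * y ^ k) + \<rho> y * y ^ 4"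
    and lim: "\<And>c. c \<noteq> 0 \<Longrightarrow> ((\<lambda>h. \<rho> (c * h)) \<longlongrightarrow> p gchoose 4) (at_right 0)"
    using powr_taylor_remainder by blast
  define F where "F h = 45/2 * ((p gchoose 2) * x\<^sup>2 + 2 * (p gchoose 3) * x)
      + 16 * \<rho> (2 * h) * (2 * (x * h) + 1)\<^sup>2 + \<rho> (- (1/2) * h) / 16 * (2 - x * h)\<^sup>2
      + 16 * \<rho> (- 2 * h) * (2 * (x * h) - 1)\<^sup>2 + \<rho> (1/2 * h) / 16 * (2 + x * h)\<^sup>2
      - 5 * (\<rho> (1 * h) * (x * h + 1)\<^sup>2 + \<rho> (- 1 * h) * (1 - x * h)\<^sup>2)" for h
  have "0 \<le> F h" if h: "0 < h" and le: "\<forall>u. (g h * (u + 1)\<^sup>2 + g (- h) * (1 - u)\<^sup>2) / 2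
      \<le> ((g (2 * h) * (2 * u + 1)\<^sup>2 + g (- h / 2) * (2 - u)\<^sup>2) / 5
        + (g (- 2 * h) * (2 * u - 1)\<^sup>2 + g (h / 2) * (2 + u)\<^sup>2) / 5) / 2" for h
  proof -
    have g: "g y = 1 + p * y + (p gchoose 2) * y\<^sup>2 + (p gchoose 3) * y ^ 3 + \<rho> y * y ^ 4" for y
      unfolding g_def \<rho> by (simp add: numeral_eq_Suc)
    define u where "u = x * h"
    have "0 \<le> c + d + (e + f) - 5 * (a + b)" if "(a + b) / 2 \<le> ((c + d) / 5 + (e + f) / 5) / 2"
      for a b c d e f :: real
      using that by (simp add: field_simps)
    from this[OF le[rule_format, of u]]
    have "0 \<le> g (2 * h) * (2 * u + 1)\<^sup>2 + g (- h / 2) * (2 - u)\<^sup>2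
        + (g (- 2 * h) * (2 * u - 1)\<^sup>2 + g (h / 2) * (2 + u)\<^sup>2)
        - 5 * (g h * (u + 1)\<^sup>2 + g (- h) * (1 - u)\<^sup>2)"
      .
    also have "\<dots> = h ^ 4 * F h"
      unfolding g F_def u_def by (simp add: field_simps power2_eq_square power3_eq_cube power4_eq_xxxx)
    finally show ?thesis using h by (simp add: zero_le_mult_iff)
  qed
  moreover have "\<forall>\<^sub>F h in at_right (0::real). 0 < h" by (simp add: eventually_at_filter)
  ultimately have "\<forall>\<^sub>F h in at_right 0. 0 \<le> F h"
    using assms(2) by (auto elim: eventually_elim2)
  moreover have "(F \<longlongrightarrow> 45/2 * ((p gchoose 2) * x\<^sup>2 + 2 * (p gchoose 3) * x)
      + 16 * (p gchoose 4) * (2 * (x * 0) + 1)\<^sup>2 + (p gchoose 4) / 16 * (2 - x * 0)\<^sup>2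
      + 16 * (p gchoose 4) * (2 * (x * 0) - 1)\<^sup>2 + (p gchoose 4) / 16 * (2 + x * 0)\<^sup>2
      - 5 * ((p gchoose 4) * (x * 0 + 1)\<^sup>2 + (p gchoose 4) * (1 - x * 0)\<^sup>2)) (at_right 0)"
    unfolding F_def by (intro tendsto_intros lim) auto
  ultimately show ?thesis
    using tendsto_lowerbound[of F _ "at_right 0" 0] by (fastforce simp: field_simps)
qed

text \<open>The eigenvectors are \<open>(x, y)\<close> for \<open>a\<close> and \<open>(-y, x)\<close> for \<open>b\<close>.\<close>

definition sym2 :: "real \<Rightarrow> real \<Rightarrow> real \<Rightarrow> real \<Rightarrow> complex mat" where
  "sym2 x y a b = (let N = x\<^sup>2 + y\<^sup>2; q = complex_of_real ((a - b) * x * y / N) in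
     mat2 (complex_of_real ((a * x\<^sup>2 + b * y\<^sup>2) / N)) q q (complex_of_real ((a * y\<^sup>2 + b * x\<^sup>2) / N)))"

text \<open>The rotation with cosine \<open>c\<close> and sine \<open>s\<close> depends only on
  \<open>x\<close> and \<open>y\<close>. It is therefore obtained before \<open>a\<close> and
  \<open>b\<close>, and one \<open>U\<close> also serves for the values of \<open>f\<close> at the
  eigenvalues.\<close>

lemma sym2_spectral_decomposition:
  assumes "x \<noteq> 0"
  obtains U where "\<And>a b. spectral_decomposition 2 (sym2 x y a b) U (\<lambda>i. if i = 0 then a else b)"
proof -
  define N where "N = sqrt (x\<^sup>2 + y\<^sup>2)"
  have N: "N * N = x\<^sup>2 + y\<^sup>2" "N \<noteq> 0"
    using assms by (simp_all add: N_def add_pos_nonneg)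
  define c where "c = x / N"
  define s where "s = y / N"
  have cs: "c * c + s * s = 1" "c * c = x\<^sup>2 / (x\<^sup>2 + y\<^sup>2)" "s * s = y\<^sup>2 / (x\<^sup>2 + y\<^sup>2)"
    "c * s = x * y / (x\<^sup>2 + y\<^sup>2)"
    using N assms by (simp_all add: c_def s_def power2_eq_square flip: add_divide_distrib)
  define U where "U = mat2 (complex_of_real c) (complex_of_real (- s)) (complex_of_real s) (complex_of_real c)"
  have "unitary_mat 2 U"
    using cs(1) by (simp add: unitary_mat_def U_def mat2_arith mult.commute add.commute flip: of_real_mult of_real_add)
  moreover have "sym2 x y a b = U * real_diag 2 (\<lambda>i. if i = 0 then a else b) * mat_adjoint U" for a b
  proof -
    have eqs: "(a * x\<^sup>2 + b * y\<^sup>2) / (x\<^sup>2 + y\<^sup>2) = c * a * c + s * b * s"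
      "(a - b) * x * y / (x\<^sup>2 + y\<^sup>2) = c * a * s - s * b * c"
      "(a * y\<^sup>2 + b * x\<^sup>2) / (x\<^sup>2 + y\<^sup>2) = s * a * s + c * b * c"
      using cs(2-) by (simp_all add: add_divide_distrib diff_divide_distrib left_diff_distrib
          right_diff_distrib mult_ac)
    show ?thesis
      unfolding sym2_def Let_def eqs by (simp add: U_def mat2_arith mat2_eq_iff mult_ac)
  qed
  ultimately show thesis using that by (simp add: spectral_decomposition_def)
qed

lemma sym2_mat_fun:
  assumes "x \<noteq> 0"
  shows "mat_fun 2 f (sym2 x y a b) = sym2 x y (f a) (f b)"
proof -
  obtain U where U: "\<And>a b. spectral_decomposition 2 (sym2 x y a b) U (\<lambda>i. if i = 0 then a else b)"
    using sym2_spectral_decomposition[OF assms] by blast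
  have "(\<lambda>i. f (if i = 0 then a else b)) = (\<lambda>i::nat. if i = 0 then f a else f b)" by auto
  then show ?thesis
    using mat_fun_eq[OF U, of f a b] U[of "f a" "f b"] by (simp add: spectral_decomposition_def)
qed

lemma sym2_hermitian_with_spectrum_in:
  assumes "x \<noteq> 0" "a \<in> I" "b \<in> I"
  shows "sym2 x y a b \<in> hermitian_with_spectrum_in 2 I"
proof -
  obtain U where U: "\<And>a b. spectral_decomposition 2 (sym2 x y a b) U (\<lambda>i. if i = 0 then a else b)"
    using sym2_spectral_decomposition[OF assms(1)] by blast
  show ?thesis by (rule spectral_decomposition_in[OF U]) (use assms in auto)
qed

text \<open>The two squares are those of the inner products of (u, 1) with the eigenvectors (x, y)
  and (-y, x).\<close>

lemma sym2_quadratic_form: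
  assumes "x \<noteq> 0"
  shows "Re ((sym2 x y a b *\<^sub>v vec 2 (\<lambda>i. complex_of_real (if i = 0 then u else 1)))
      \<bullet>c vec 2 (\<lambda>i. complex_of_real (if i = 0 then u else 1)))
    = (a * (x * u + y)\<^sup>2 + b * (x - y * u)\<^sup>2) / (x\<^sup>2 + y\<^sup>2)"
proof -
  have "(a * (x * u + y)\<^sup>2 + b * (x - y * u)\<^sup>2) / N
      = ((a * x\<^sup>2 + b * y\<^sup>2) / N * u + (a - b) * x * y / N) * u
        + ((a - b) * x * y / N * u + (a * y\<^sup>2 + b * x\<^sup>2) / N)" if "N \<noteq> 0" for N
    using that by (simp add: field_simps power2_eq_square)
  from this[of "x\<^sup>2 + y\<^sup>2"] show ?thesis
    using assms unfolding mat2_quadratic_form sym2_def Let_def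
    by (simp add: sum_power2_eq_zero_iff flip: of_real_mult of_real_add)
qed

lemma carrier_sym2 [simp]: "sym2 x y a b \<in> carrier_mat 2 2"
  and hermitian_sym2 [simp]: "hermitian_mat (sym2 x y a b)"
  by (simp_all add: sym2_def Let_def hermitian_mat_def mat2_arith)

text \<open>The bound \<open>2 * h\<close> covers every relative perturbation of \<open>t\<close>
  among the eigenvalues of the test matrices.\<close>

lemma interior_scaling_eventually:
  fixes t :: real
  assumes t: "t \<in> interior I" "0 < t"
  shows "\<forall>\<^sub>F h in at_right 0. 0 < h \<and> (\<forall>s. \<bar>s\<bar> \<le> 2 * h \<longrightarrow> t * (1 + s) \<in> I)"
proof -
  obtain \<delta> where \<delta>: "0 < \<delta>" "ball t \<delta> \<subseteq> I"
    using t(1) by (auto simp: mem_interior)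
  have "t * (1 + s) \<in> I" if "h < \<delta> / (2 * t)" "\<bar>s\<bar> \<le> 2 * h" for h s
  proof -
    have "dist t (t * (1 + s)) = t * \<bar>s\<bar>"
      using t(2) by (simp add: dist_real_def algebra_simps abs_mult)
    also have "\<dots> \<le> t * (2 * h)" using that(2) t(2) by simp
    also have "\<dots> < \<delta>" using that(1) t(2) by (simp add: field_simps)
    finally show ?thesis using \<delta>(2) by auto
  qed
  then show ?thesis
    using \<delta>(1) t(2) by (auto simp: eventually_at_right_field intro!: exI[of _ "\<delta> / (2 * t)"])
qed

text \<open>Multiplicativity of powers splits off the positive factor \<open>t powr p\<close>, which
  later cancels, so the expansion takes place around 1.\<close>

lemma sym2_powr_form:
  assumes I: "I \<subseteq> {0<..}" and f: "\<And>t. t \<in> I \<Longrightarrow> f t = t powr p"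
    and "x \<noteq> 0" "0 < t" and a: "t * (1 + a) \<in> I" and b: "t * (1 + b) \<in> I"
  shows "Re ((mat_fun 2 f (sym2 x y (t * (1 + a)) (t * (1 + b))) *\<^sub>v vec 2 (\<lambda>i. complex_of_real (if i = 0 then u else 1)))
      \<bullet>c vec 2 (\<lambda>i. complex_of_real (if i = 0 then u else 1)))
    = t powr p * (((1 + a) powr p * (x * u + y)\<^sup>2 + (1 + b) powr p * (x - y * u)\<^sup>2) / (x\<^sup>2 + y\<^sup>2))"
proof -
  have "0 < t * (1 + a)" "0 < t * (1 + b)" using a b I by auto
  then have "f (t * (1 + a)) = t powr p * (1 + a) powr p" "f (t * (1 + b)) = t powr p * (1 + b) powr p"
    using f[OF a] f[OF b] \<open>0 < t\<close> by (simp_all add: powr_mult zero_less_mult_iff)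
  then show ?thesis
    unfolding sym2_mat_fun[OF \<open>x \<noteq> 0\<close>] sym2_quadratic_form[OF \<open>x \<noteq> 0\<close>]
    by (simp add: algebra_simps)
qed

text \<open>Up to the factor \<open>t\<close> these are \<open>1 + hZ\<close>, \<open>1 + hX\<close> and \<open>1 + hY\<close>, where \<open>Z\<close> has rows \<open>(0, 1)\<close> and
  \<open>(1, 0)\<close>, and \<open>X\<close>, \<open>Y\<close> are \<open>Z\<close> plus or minus \<open>3/2\<close> times the projection onto the first
  coordinate. The factor \<open>3/2\<close> makes all eigenvalues rational. On the test vector \<open>(xh, 1)\<close> the
  lower order terms of the matrix inequalities cancel, which leaves a quadratic polynomial in \<open>x\<close>.\<close>

lemma sym2_near_scalar:
  fixes t h :: real
  shows "sym2 1 1 (t * (1 + h)) (t * (1 + - h)) = mat2 t (t * h) (t * h) t"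
    and "sym2 2 1 (t * (1 + 2 * h)) (t * (1 + - h / 2)) = mat2 (t * (1 + 3/2 * h)) (t * h) (t * h) t"
    and "sym2 2 (- 1) (t * (1 + - 2 * h)) (t * (1 + h / 2)) = mat2 (t * (1 - 3/2 * h)) (t * h) (t * h) t"
proof -
  have eq: "sym2 x y a b = mat2 (complex_of_real q) (complex_of_real r) (complex_of_real r) (complex_of_real s)"
    if "(a * x\<^sup>2 + b * y\<^sup>2) / (x\<^sup>2 + y\<^sup>2) = q" "(a - b) * x * y / (x\<^sup>2 + y\<^sup>2) = r"
      "(a * y\<^sup>2 + b * x\<^sup>2) / (x\<^sup>2 + y\<^sup>2) = s" for x y a b q r s
    using that by (simp only: sym2_def Let_def)
  show "sym2 1 1 (t * (1 + h)) (t * (1 + - h)) = mat2 t (t * h) (t * h) t"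
    "sym2 2 1 (t * (1 + 2 * h)) (t * (1 + - h / 2)) = mat2 (t * (1 + 3/2 * h)) (t * h) (t * h) t"
    "sym2 2 (- 1) (t * (1 + - 2 * h)) (t * (1 + h / 2)) = mat2 (t * (1 - 3/2 * h)) (t * h) (t * h) t"
    by (rule eq; simp add: field_simps)+
qed

section \<open>Necessary conditions on the exponent\<close>

lemma n_monotone_on_2_powr_imp:
  assumes I: "interior I \<noteq> {}" "I \<subseteq> {0<..}" and f: "\<And>t. t \<in> I \<Longrightarrow> f t = t powr p"
    and mono: "n_monotone_on 2 I f"
  shows "0 \<le> p \<and> p \<le> 1"
proof -
  obtain t where t: "t \<in> interior I" using I(1) by blast
  have t0: "0 < t" using t I(2) interior_subset by blast
  have "\<forall>\<^sub>F h in at_right 0. \<forall>u.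
     ((1 + h) powr p * (u + 1)\<^sup>2 + (1 + - h) powr p * (1 - u)\<^sup>2) / 2
      \<le> ((1 + 2 * h) powr p * (2 * u + 1)\<^sup>2 + (1 + - h / 2) powr p * (2 - u)\<^sup>2) / 5"
    using interior_scaling_eventually[OF t t0]
  proof eventually_elim
    case (elim h)
    then have h: "0 < h" by simp
    have *: "t * (1 + s) \<in> I" if "\<bar>s\<bar> \<le> 2 * h" for s using that elim by blast
    have in_I: "t * (1 + h) \<in> I" "t * (1 + - h) \<in> I" "t * (1 + 2 * h) \<in> I" "t * (1 + - h / 2) \<in> I"
      by (rule *; use h in simp)+
    let ?Z = "sym2 1 1 (t * (1 + h)) (t * (1 + - h))"
    let ?X = "sym2 2 1 (t * (1 + 2 * h)) (t * (1 + - h / 2))"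
    have "loewner_le 2 ?Z ?X"
      unfolding loewner_le_iff[OF carrier_sym2 carrier_sym2 hermitian_sym2 hermitian_sym2]
    proof
      fix v :: "complex vec" assume "v \<in> carrier_vec 2"
      then have v: "v = vec 2 (\<lambda>i. v $ i)" by auto
      \<comment> \<open>The difference of the matrices is \<open>3/2 * (t * h)\<close> times the
        projection onto the first coordinate.\<close>
      have "Re ((?X *\<^sub>v v) \<bullet>c v) = Re ((?Z *\<^sub>v v) \<bullet>c v) + 3/2 * (t * h) * ((Re (v $ 0))\<^sup>2 + (Im (v $ 0))\<^sup>2)"
        unfolding sym2_near_scalar
        by (subst (1 2 3 4) v, unfold mat2_quadratic_form) (simp add: power2_eq_square algebra_simps)
      then show "Re ((?Z *\<^sub>v v) \<bullet>c v) \<le> Re ((?X *\<^sub>v v) \<bullet>c v)"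
        using t0 h by simp
    qed
    moreover have "?Z \<in> hermitian_with_spectrum_in 2 I" "?X \<in> hermitian_with_spectrum_in 2 I"
      using in_I by (simp_all only: sym2_hermitian_with_spectrum_in zero_neq_numeral[symmetric] not_False_eq_True one_neq_zero)
    ultimately have le: "loewner_le 2 (mat_fun 2 f ?Z) (mat_fun 2 f ?X)"
      using mono unfolding n_monotone_on_def by blast
    show ?case
    proof
      fix u
      let ?w = "vec 2 (\<lambda>i. complex_of_real (if i = 0 then u else 1))"
      have "Re ((mat_fun 2 f ?Z *\<^sub>v ?w) \<bullet>c ?w) \<le> Re ((mat_fun 2 f ?X *\<^sub>v ?w) \<bullet>c ?w)"
        using le by (simp add: sym2_mat_fun loewner_le_iff[OF carrier_sym2 carrier_sym2 hermitian_sym2 hermitian_sym2])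
      moreover have "Re ((mat_fun 2 f ?Z *\<^sub>v ?w) \<bullet>c ?w)
          = t powr p * (((1 + h) powr p * (u + 1)\<^sup>2 + (1 + - h) powr p * (1 - u)\<^sup>2) / 2)"
        by (subst sym2_powr_form[OF I(2) f _ t0 in_I(1,2)]) simp_all
      moreover have "Re ((mat_fun 2 f ?X *\<^sub>v ?w) \<bullet>c ?w)
          = t powr p * (((1 + 2 * h) powr p * (2 * u + 1)\<^sup>2 + (1 + - h / 2) powr p * (2 - u)\<^sup>2) / 5)"
        by (subst sym2_powr_form[OF I(2) f _ t0 in_I(3,4)]) simp_all
      ultimately show "((1 + h) powr p * (u + 1)\<^sup>2 + (1 + - h) powr p * (1 - u)\<^sup>2) / 2
          \<le> ((1 + 2 * h) powr p * (2 * u + 1)\<^sup>2 + (1 + - h / 2) powr p * (2 - u)\<^sup>2) / 5"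
        using t0 by (simp only: mult_le_cancel_left_pos powr_gt_zero)
    qed
  qed
  then have "0 \<le> p * x\<^sup>2 + 2 * (p gchoose 2) * x + (p gchoose 3)" for x
    by (rule powr_expansion_monotone)
  from quadratic_nonneg_imp[OF this]
  have p: "0 \<le> p" and "(p gchoose 2)\<^sup>2 \<le> p * (p gchoose 3)" by auto
  \<comment> \<open>This is the discriminant condition multiplied by 12, with the common factor p^2
    taken out.\<close>
  then have "0 \<le> p\<^sup>2 * ((1 - p) * (1 + p))"
    by (simp add: gbinomial_2_3_4 power2_eq_square field_simps)
  then have "p = 0 \<or> 0 \<le> (1 - p) * (1 + p)"
    by (auto simp: zero_le_mult_iff)
  then show ?thesis using p by (auto simp: zero_le_mult_iff)
qed

lemma n_convex_on_2_powr_imp: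
  assumes I: "interior I \<noteq> {}" "I \<subseteq> {0<..}" and f: "\<And>t. t \<in> I \<Longrightarrow> f t = t powr p"
    and conv: "n_convex_on 2 I f"
  shows "1 \<le> p \<and> p \<le> 2 \<or> -1 \<le> p \<and> p \<le> 0"
proof -
  obtain t where t: "t \<in> interior I" using I(1) by blast
  have t0: "0 < t" using t I(2) interior_subset by blast
  have "\<forall>\<^sub>F h in at_right 0. \<forall>u.
     ((1 + h) powr p * (u + 1)\<^sup>2 + (1 + - h) powr p * (1 - u)\<^sup>2) / 2
      \<le> (((1 + 2 * h) powr p * (2 * u + 1)\<^sup>2 + (1 + - h / 2) powr p * (2 - u)\<^sup>2) / 5
        + ((1 + - 2 * h) powr p * (2 * u - 1)\<^sup>2 + (1 + h / 2) powr p * (2 + u)\<^sup>2) / 5) / 2"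
    using interior_scaling_eventually[OF t t0]
  proof eventually_elim
    case (elim h)
    then have h: "0 < h" by simp
    have *: "t * (1 + s) \<in> I" if "\<bar>s\<bar> \<le> 2 * h" for s using that elim by blast
    have in_I: "t * (1 + h) \<in> I" "t * (1 + - h) \<in> I" "t * (1 + 2 * h) \<in> I" "t * (1 + - h / 2) \<in> I"
      "t * (1 + - 2 * h) \<in> I" "t * (1 + h / 2) \<in> I"
      by (rule *; use h in simp)+
    let ?Z = "sym2 1 1 (t * (1 + h)) (t * (1 + - h))"
    let ?X = "sym2 2 1 (t * (1 + 2 * h)) (t * (1 + - h / 2))"
    let ?Y = "sym2 2 (- 1) (t * (1 + - 2 * h)) (t * (1 + h / 2))"
    let ?half = "\<lambda>X Y. complex_of_real (1/2) \<cdot>\<^sub>m X + complex_of_real (1 - 1/2) \<cdot>\<^sub>m Y"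
    \<comment> \<open>The two perturbations by the projection have opposite signs and cancel at the
      midpoint.\<close>
    have Z: "?half ?X ?Y = ?Z"
      unfolding sym2_near_scalar by (simp add: mat2_arith mat2_eq_iff field_simps)
    have "?X \<in> hermitian_with_spectrum_in 2 I" "?Y \<in> hermitian_with_spectrum_in 2 I"
      using in_I by (simp_all only: sym2_hermitian_with_spectrum_in zero_neq_numeral[symmetric] not_False_eq_True)
    then have "loewner_le 2 (mat_fun 2 f (?half ?X ?Y)) (?half (mat_fun 2 f ?X) (mat_fun 2 f ?Y))"
      using conv unfolding n_convex_on_def by (elim ballE[of _ _ ?X] ballE[of _ _ ?Y] ballE[of _ _ "1/2"]) auto
    then have le: "loewner_le 2 (mat_fun 2 f ?Z) (?half (mat_fun 2 f ?X) (mat_fun 2 f ?Y))"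
      unfolding Z .
    show ?case
    proof
      fix u
      let ?w = "vec 2 (\<lambda>i. complex_of_real (if i = 0 then u else 1))"
      let ?q = "\<lambda>M. Re ((M *\<^sub>v ?w) \<bullet>c ?w)"
      have c: "mat_fun 2 f ?X \<in> carrier_mat 2 2" "mat_fun 2 f ?Y \<in> carrier_mat 2 2" "mat_fun 2 f ?Z \<in> carrier_mat 2 2"
        and herm: "hermitian_mat (mat_fun 2 f ?X)" "hermitian_mat (mat_fun 2 f ?Y)" "hermitian_mat (mat_fun 2 f ?Z)"
        by (simp_all add: sym2_mat_fun)
      have "?q (mat_fun 2 f ?Z) \<le> ?q (?half (mat_fun 2 f ?X) (mat_fun 2 f ?Y))"
        using le[unfolded loewner_le_iff[OF c(3) add_carrier_mat[OF smult_carrier_mat[OF c(2)]] herm(3)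
            hermitian_mat_combination[OF c(1,2) herm(1,2)]]] by (rule bspec) simp
      also have "\<dots> = (?q (mat_fun 2 f ?X) + ?q (mat_fun 2 f ?Y)) / 2"
        by (subst quadratic_form_combination[OF c(1,2)]) simp_all
      also have "?q (mat_fun 2 f ?Z)
          = t powr p * (((1 + h) powr p * (u + 1)\<^sup>2 + (1 + - h) powr p * (1 - u)\<^sup>2) / 2)"
        by (subst sym2_powr_form[OF I(2) f _ t0 in_I(1,2)]) simp_all
      also have "?q (mat_fun 2 f ?X)
          = t powr p * (((1 + 2 * h) powr p * (2 * u + 1)\<^sup>2 + (1 + - h / 2) powr p * (2 - u)\<^sup>2) / 5)"
        by (subst sym2_powr_form[OF I(2) f _ t0 in_I(3,4)]) simp_all
      also have "?q (mat_fun 2 f ?Y)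
          = t powr p * (((1 + - 2 * h) powr p * (2 * u - 1)\<^sup>2 + (1 + h / 2) powr p * (2 + u)\<^sup>2) / 5)"
        by (subst sym2_powr_form[OF I(2) f _ t0 in_I(5,6)]) simp_all
      finally show "((1 + h) powr p * (u + 1)\<^sup>2 + (1 + - h) powr p * (1 - u)\<^sup>2) / 2
        \<le> (((1 + 2 * h) powr p * (2 * u + 1)\<^sup>2 + (1 + - h / 2) powr p * (2 - u)\<^sup>2) / 5
          + ((1 + - 2 * h) powr p * (2 * u - 1)\<^sup>2 + (1 + h / 2) powr p * (2 + u)\<^sup>2) / 5) / 2"
        unfolding distrib_left[symmetric] times_divide_eq_right[symmetric]
        using t0 by (simp only: mult_le_cancel_left_pos powr_gt_zero)
    qed
  qed
  then have "0 \<le> (p gchoose 2) * x\<^sup>2 + 2 * (p gchoose 3) * x + (p gchoose 4)" for x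
    by (rule powr_expansion_convex)
  from quadratic_nonneg_imp[OF this]
  have p: "0 \<le> p * (p - 1)" and "(p gchoose 3)\<^sup>2 \<le> (p gchoose 2) * (p gchoose 4)"
    by (auto simp: gbinomial_2_3_4)
  \<comment> \<open>This is the discriminant condition multiplied by 144. Where the square vanishes,
    \<open>p\<close> is 0 or 1, and both are admissible.\<close>
  then have "0 \<le> (p * (p - 1))\<^sup>2 * ((2 - p) * (p + 1))"
    by (simp add: gbinomial_2_3_4 power2_eq_square field_simps)
  then have "p = 0 \<or> p = 1 \<or> 0 \<le> (2 - p) * (p + 1)"
    by (auto simp: zero_le_mult_iff)
  then show ?thesis using p by (auto simp: zero_le_mult_iff)
qed

theorem proposition3p1:
  fixes I :: "real set" and p :: real and f :: "real \<Rightarrow> real"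
  assumes "is_interval I" and "interior I \<noteq> {}" and "I \<subseteq> {0<..}"
    and "\<And>t. t \<in> I \<Longrightarrow> f t = t powr p"
  shows "(n_monotone_on 2 I f \<longleftrightarrow> 0 \<le> p \<and> p \<le> 1) \<and>
         (n_convex_on 2 I f \<longleftrightarrow> (1 \<le> p \<and> p \<le> 2) \<or> (-1 \<le> p \<and> p \<le> 0))"
  using n_monotone_on_2_powr[OF assms(3,4)] n_monotone_on_2_powr_imp[OF assms(2-4)]
    n_convex_on_2_powr[OF assms(3) _ assms(4)] n_convex_on_2_powr_imp[OF assms(2-4)]
    is_interval_convex[OF assms(1)] by blast

end
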